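(* Let $\alpha\in(0,1)$, $d\ge 1$, $A\in\mathbb{R}^{d\times d}$, and let $f:\mathbb{R}^d\to\mathbb{R}^d$ be continuous on $\mathbb{R}^d$ and Lipschitz continuous on a neighborhood of the origin. Consider the nonlinear Caputo fractional differential equation $$^{C}D_{0+}^{\alpha}x(t)=Ax(t)+f(x(t)),\qquad t\ge 0,\ x(t)\in\mathbb{R}^d .$$ Assume that the spectrum $\sigma(A)\subset\mathbb{C}$ of $A$ satisfies $$\sigma(A)\cap\Big\{z\in\mathbb{C}\setminus\{0\}: |\arg(z)|<\tfrac{\alpha\pi}{2}\Big\}\neq\emptyset,$$ and that $$f(0)=0\quad\text{and}\quad \lim_{r\to0}\ell_f(r)=0,\qquad\text{where}\quad \ell_f(r):=\sup_{\substack{\|x\|\le r,\ \|y\|\le r\\ x\ne y}}\frac{\|f(x)-f(y)\|}{\|x-y\|}.$$ Then the trivial solution $x\equiv 0$ of this equation is unstable.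
   Context: $\|\cdot\|$ is a fixed norm on $\mathbb{R}^d$. For $z\in\mathbb{C}\setminus\{0\}$ the argument is taken with $-\pi<\arg(z)\le\pi$. Fractional calculus: for $\beta>0$ the Riemann--Liouville integral is $(I_{0+}^{\beta}x)(t)=\frac{1}{\Gamma(\beta)}\int_0^t(t-\tau)^{\beta-1}x(\tau)\,d\tau$. For $\alpha\in(0,1)$ the Caputo derivative of a $C^1$ function is $(^{C}D_{0+}^{\alpha}x)(t)=(I_{0+}^{1-\alpha}x')(t)$, taken componentwise for vector functions. As usual, a solution of $^{C}D_{0+}^{\alpha}x=Ax+f(x)$ with $x(0)=x_0$ on an interval $[0,b)$ is understood as a continuous function satisfying the equivalent Volterra equation $x(t)=x_0+\frac{1}{\Gamma(\alpha)}\int_0^t(t-\tau)^{\alpha-1}\big(Ax(\tau)+f(x(\tau))\big)\,d\tau$ for $t\in[0,b)$. For $x_0\in\mathbb{R}^d$ in a neighborhood of $0$, $\varphi(\cdot,x_0)$ denotes the solution with $\varphi(0,x_0)=x_0$ on its maximal interval of existence $[0,t_{\max}(x_0))$, $0<t_{\max}(x_0)\le\infty$ (it is unique as long as it stays in the neighborhood where $f$ is Lipschitz). Stability: the trivial solution is called stable if for every $\varepsilon>0$ there exists $\delta=\delta(\varepsilon)>0$ such that for every $x_0$ with $\|x_0\|<\delta$ one has $t_{\max}(x_0)=\infty$ and $\|\varphi(t,x_0)\|\le\varepsilon$ for all $t\ge0$. It is called unstable if it is not stable. *)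

theory Defs
  imports "HOL-Analysis.Analysis"
begin

definition is_norm :: "('a::real_vector \<Rightarrow> real) \<Rightarrow> bool" where
  "is_norm N \<longleftrightarrow>
     (\<forall>x. N x \<ge> 0) \<and> (\<forall>x. N x = 0 \<longleftrightarrow> x = 0) \<and>
     (\<forall>c x. N (c *\<^sub>R x) = \<bar>c\<bar> * N x) \<and> (\<forall>x y. N (x + y) \<le> N x + N y)"

definition spectrum :: "real ^ 'n ^ 'n \<Rightarrow> complex set" where
  "spectrum A = {z. \<exists>v :: complex ^ 'n. v \<noteq> 0 \<and> map_matrix complex_of_real A *v v = z *s v}"

text \<open>The supremum is taken in the extended reals, so that it is infinite (rather than
  unspecified) on balls where \<open>f\<close> is not Lipschitz.\<close>

definition lip_modulus :: "('a::real_vector \<Rightarrow> real) \<Rightarrow> ('a \<Rightarrow> 'a) \<Rightarrow> real \<Rightarrow> ereal" where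
  "lip_modulus N f r =
     (SUP (x, y) \<in> {(x, y). N x \<le> r \<and> N y \<le> r \<and> x \<noteq> y}. ereal (N (f x - f y) / N (x - y)))"

definition RL_integral :: "real \<Rightarrow> (real \<Rightarrow> 'a::euclidean_space) \<Rightarrow> real \<Rightarrow> 'a" where
  "RL_integral \<beta> x t =
     (1 / Gamma \<beta>) *\<^sub>R integral {0..t} (\<lambda>\<tau>. (t - \<tau>) powr (\<beta> - 1) *\<^sub>R x \<tau>)"

text \<open>Solutions on \<open>[0, b)\<close> of the Caputo equation of order \<open>\<alpha>\<close> with right-hand side \<open>F x(t)\<close>
  and initial value \<open>x0\<close>, in the sense of the equivalent Volterra integral equation.\<close>

definition caputo_solution ::
  "real \<Rightarrow> ('a \<Rightarrow> 'a) \<Rightarrow> 'a \<Rightarrow> ereal \<Rightarrow> (real \<Rightarrow> 'a::euclidean_space) \<Rightarrow> bool" where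
  "caputo_solution \<alpha> F x0 b x \<longleftrightarrow>
     continuous_on {t. 0 \<le> t \<and> ereal t < b} x \<and>
     (\<forall>t. 0 \<le> t \<and> ereal t < b \<longrightarrow> x t = x0 + RL_integral \<alpha> (\<lambda>\<tau>. F (x \<tau>)) t)"

definition maximal_caputo_solution ::
  "real \<Rightarrow> ('a \<Rightarrow> 'a) \<Rightarrow> 'a \<Rightarrow> ereal \<Rightarrow> (real \<Rightarrow> 'a::euclidean_space) \<Rightarrow> bool" where
  "maximal_caputo_solution \<alpha> F x0 tmax \<phi> \<longleftrightarrow>
     0 < tmax \<and> caputo_solution \<alpha> F x0 tmax \<phi> \<and>
     (\<forall>b y. tmax < b \<and> caputo_solution \<alpha> F x0 b y \<longrightarrow>
        \<not> (\<forall>t. 0 \<le> t \<and> ereal t < tmax \<longrightarrow> y t = \<phi> t))"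

text \<open>If \<open>F\<close> is merely continuous away from the origin, a maximal solution need not be unique
  once it has left the neighbourhood where \<open>F\<close> is Lipschitz.  This does not affect stability:
  for \<open>\<epsilon>\<close> so small that the \<open>\<epsilon>\<close>-ball lies in that neighbourhood, a global solution staying
  in the ball is the only maximal solution, and a \<open>\<delta>\<close> that works for a small \<open>\<epsilon>\<close> works for all
  larger ones.  Hence it suffices to ask for some maximal solution below.\<close>

definition trivial_solution_stable ::
  "('a::euclidean_space \<Rightarrow> real) \<Rightarrow> real \<Rightarrow> ('a \<Rightarrow> 'a) \<Rightarrow> bool" where
  "trivial_solution_stable N \<alpha> F \<longleftrightarrow>
     (\<forall>\<epsilon>>0. \<exists>\<delta>>0. \<forall>x0. N x0 < \<delta> \<longrightarrow>
        (\<exists>tmax \<phi>. maximal_caputo_solution \<alpha> F x0 tmax \<phi> \<and>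
           tmax = \<infinity> \<and> (\<forall>t\<ge>0. N (\<phi> t) \<le> \<epsilon>)))"

definition trivial_solution_unstable ::
  "('a::euclidean_space \<Rightarrow> real) \<Rightarrow> real \<Rightarrow> ('a \<Rightarrow> 'a) \<Rightarrow> bool" where
  "trivial_solution_unstable N \<alpha> F \<longleftrightarrow> \<not> trivial_solution_stable N \<alpha> F"

end

theory Submission
  imports Defs "HOL-Probability.Characteristic_Functions"
begin

text \<open>The Laplace transform turns stability into a contradiction between two estimates.

Suppose the trivial solution is stable, and let \<open>x\<close> be a bounded global solution that starts at
\<open>x0\<close>.  Put \<open>g t = f (x t)\<close>.  Since \<open>x\<close> stays in a small ball, the norm of \<open>g t\<close> is at most
\<open>\<eta>\<close> times the norm of \<open>x t\<close>, with \<open>\<eta>\<close> as small as desired.  In the half plane \<open>Re s > 0\<close> the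
transforms satisfy \<open>X(s) = x0 / s + s powr (- \<alpha>) * (A X(s) + G(s))\<close>
(lemma \<open>laplace_equation\<close>).

Let \<open>\<mu>\<close> be an eigenvalue in the sector and \<open>s0 = \<mu> powr (1 / \<alpha>)\<close>, so that \<open>Re s0 > 0\<close>.  Pairing the
equation at \<open>s0\<close> with a left eigenvector \<open>w\<close> cancels \<open>X(s0)\<close> and bounds the component of \<open>x0\<close> along
\<open>w\<close> by a multiple of the norm of \<open>G(s0)\<close> (lemma \<open>unstable_component_constraint\<close>).  A bound for \<open>G\<close>
in terms of the radius of the ball would be useless here, because \<open>x0\<close> may be much smaller.  What
is needed is that \<open>G(s0)\<close> is at most a multiple of \<open>\<eta>\<close> times the norm of \<open>x0\<close>.

This comes from a noncausal estimate.  Choose \<open>c\<close> strictly between \<open>0\<close> and \<open>Re s0\<close> such that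
\<open>s powr \<alpha>\<close> is never an eigenvalue on the line \<open>Re s = c\<close> (lemma \<open>line_avoiding_spectrum\<close>).  On this
line the operator \<open>1 - s powr (- \<alpha>) * A\<close> is uniformly invertible, so the norm of \<open>X\<close> is bounded by a
multiple of that of \<open>x0 / s\<close> plus that of \<open>G\<close>.  Plancherel's identity turns this into an estimate in
the space \<open>L\<^sup>2\<close> with weight \<open>exp (- c * t)\<close>.  The norm of \<open>x\<close> there is finite since \<open>x\<close> is bounded,
hence for small \<open>\<eta>\<close> the contribution of \<open>g\<close> can be absorbed, and the weighted norm of \<open>x\<close> is at
most a multiple of the norm of \<open>x0\<close> (lemma \<open>energy_le\<close>).  As \<open>Re s0 > c\<close>, this controls \<open>G(s0)\<close>
(lemma \<open>laplace_perturbation_le\<close>).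

The component of \<open>x0\<close> along \<open>w\<close> is therefore at most a multiple of \<open>\<eta>\<close> times the norm of \<open>x0\<close>, which
is false for a suitable direction of \<open>x0\<close> and small \<open>\<eta>\<close>.

Plancherel's identity enters in a form regularised by a Gaussian (lemmas \<open>gauss_energy_le\<close> and
\<open>gauss_energy_tendsto\<close>), because the transform of \<open>x\<close> is estimated before it is known to be square
integrable.  Eigenvalues on the boundary of the sector are harmless, since the line \<open>Re s = c\<close> lies
strictly inside the right half plane and its image under \<open>s powr \<alpha>\<close> does not meet that boundary.\<close>

section \<open>Plancherel's identity with a Gaussian weight\<close>

lemma integrable_product_bounded:
  fixes g :: "real \<Rightarrow> complex" and z :: "real \<Rightarrow> real" and k :: "real \<Rightarrow> real \<Rightarrow> complex"
  assumes g: "integrable lborel g" and z: "integrable lborel z"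
    and k [measurable]: "case_prod k \<in> borel_measurable (borel \<Otimes>\<^sub>M borel)"
    and k1: "\<And>w t. cmod (k w t) \<le> 1"
  shows "integrable (lborel \<Otimes>\<^sub>M lborel) (\<lambda>(w, t). g w * (of_real (z t) * k w t))"
proof -
  note [measurable] = borel_measurable_integrable[OF g] borel_measurable_integrable[OF z]
  have "integrable (lborel \<Otimes>\<^sub>M lborel) (\<lambda>(w, t). g w * of_real (z t))"
  proof (rule lborel_pair.Fubini_integrable, goal_cases)
    case 2
    then show ?case by (simp add: norm_mult integrable_norm[OF g])
  qed (use z in auto)
  then show ?thesis
  proof (rule Bochner_Integration.integrable_bound, goal_cases)
    case 2
    have "cmod (g w) * (\<bar>z t\<bar> * cmod (k w t)) \<le> cmod (g w) * \<bar>z t\<bar>" for w t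
      using mult_left_mono[OF k1[of w t], of "cmod (g w) * \<bar>z t\<bar>"] by (simp add: mult.assoc)
    then show ?case by (auto simp: norm_mult)
  qed measurable
qed

text \<open>Applied to the kernel \<open>cis (w * t)\<close> and its conjugate, this exchanges the integration over time
inside a Fourier transform with a weighted integration over the frequency.\<close>

lemma swap_integrals_bounded:
  fixes g :: "real \<Rightarrow> complex" and z :: "real \<Rightarrow> real" and k :: "real \<Rightarrow> real \<Rightarrow> complex"
  assumes "integrable lborel g" "integrable lborel z"
    and "case_prod k \<in> borel_measurable (borel \<Otimes>\<^sub>M borel)" "\<And>w t. cmod (k w t) \<le> 1"
  shows "(LINT w|lborel. g w * (LINT t|lborel. of_real (z t) * k w t)) =
         (LINT t|lborel. of_real (z t) * (LINT w|lborel. g w * k w t))"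
proof -
  have "(LINT w|lborel. g w * (LINT t|lborel. of_real (z t) * k w t)) =
        (LINT w|lborel. (LINT t|lborel. g w * (of_real (z t) * k w t)))"
    by simp
  also have "\<dots> = (LINT t|lborel. (LINT w|lborel. g w * (of_real (z t) * k w t)))"
    using lborel_pair.Fubini_integral[OF integrable_product_bounded[OF assms]] by simp
  also have "\<dots> = (LINT t|lborel. (LINT w|lborel. of_real (z t) * (g w * k w t)))"
    by (simp only: mult.left_commute)
  finally show ?thesis by simp
qed

definition fourier :: "(real \<Rightarrow> real) \<Rightarrow> real \<Rightarrow> complex" where
  "fourier z w = (LINT t|lborel. of_real (z t) * cis (- (w * t)))"

text \<open>The weight \<open>exp (- (\<sigma> * w)\<^sup>2 / 2)\<close> tends to \<open>1\<close> as \<open>\<sigma>\<close> tends to \<open>0\<close>.  For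
\<open>\<sigma> > 0\<close> it makes all integrals absolutely convergent, so that pointwise
inequalities between transforms can be integrated.\<close>

definition gauss_energy :: "real \<Rightarrow> (real \<Rightarrow> complex) \<Rightarrow> real" where
  "gauss_energy \<sigma> Z = (LINT w|lborel. exp (- (\<sigma> * w)\<^sup>2 / 2) * (cmod (Z w))\<^sup>2)"

lemma measurable_cis [measurable]: "cis \<in> borel_measurable borel"
  by (intro borel_measurable_continuous_onI continuous_intros)

lemma measurable_cnj [measurable]: "cnj \<in> borel_measurable borel"
  by (intro borel_measurable_continuous_onI continuous_intros)

lemma measurable_fourier [measurable]:
  assumes "integrable lborel z"
  shows "fourier z \<in> borel_measurable borel"
proof -
  note [measurable] = borel_measurable_integrable[OF assms]
  show ?thesis unfolding fourier_def by measurable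
qed

lemma norm_fourier_le: "integrable lborel z \<Longrightarrow> cmod (fourier z w) \<le> (LINT t|lborel. \<bar>z t\<bar>)"
  unfolding fourier_def by (rule order_trans[OF integral_norm_bound]) (simp add: norm_mult)

lemma integrable_gaussian:
  assumes "\<sigma> > 0"
  shows "integrable lborel (\<lambda>w::real. exp (- (\<sigma> * w)\<^sup>2 / 2))"
proof -
  have "(\<lambda>w::real. exp (- (\<sigma> * w)\<^sup>2 / 2)) = (\<lambda>w. sqrt (2*pi) / \<sigma> * normal_density 0 (1/\<sigma>) w)"
    using assms by (auto simp: normal_density_def power_mult_distrib power_divide real_sqrt_mult real_sqrt_divide fun_eq_iff field_simps)
  then show ?thesis using assms by simp
qed

text \<open>After rescaling, this is the characteristic function of the standard normal distribution.\<close>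

lemma fourier_gaussian:
  assumes "\<sigma> > 0"
  shows "(LINT w|lborel. of_real (exp (- (\<sigma> * w)\<^sup>2 / 2)) * cis (w * a)) =
         complex_of_real (2 * pi * normal_density 0 \<sigma> a)"
proof -
  have "(LINT w|lborel. of_real (exp (- (\<sigma> * w)\<^sup>2 / 2)) * cis (w * a)) =
        (1 / \<sigma>) *\<^sub>R (LINT v|lborel. of_real (exp (- v\<^sup>2 / 2)) * cis (v * (a / \<sigma>)))"
    using lborel_integral_real_affine[of "1/\<sigma>" "\<lambda>w. of_real (exp (- (\<sigma> * w)\<^sup>2 / 2)) * cis (w * a)" 0] assms
    by (simp add: field_simps)
  also have "(LINT v|lborel. complex_of_real (exp (- v\<^sup>2 / 2)) * cis (v * (a / \<sigma>))) =
      complex_of_real (sqrt (2 * pi)) * (LINT v|lborel. std_normal_density v *\<^sub>R cis (v * (a / \<sigma>)))"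
    unfolding integral_mult_right_zero[symmetric]
    by (rule Bochner_Integration.integral_cong) (auto simp: std_normal_density_def scaleR_conv_of_real real_sqrt_mult)
  also have "(LINT v|lborel. std_normal_density v *\<^sub>R cis (v * (a / \<sigma>))) = char std_normal_distribution (a / \<sigma>)"
    unfolding char_def by (subst integral_density) (auto simp: cis_conv_exp mult_ac)
  also have "\<dots> = complex_of_real (exp (- ((a / \<sigma>)\<^sup>2) / 2))"
    by (simp add: char_std_normal_distribution)
  also have "(1 / \<sigma>) *\<^sub>R (complex_of_real (sqrt (2 * pi)) * \<dots>) = complex_of_real (2 * pi * normal_density 0 \<sigma> a)"
  proof -
    define r where "r = sqrt (2 * pi)"
    have r: "2 * pi = r * r" "r > 0" by (auto simp: r_def)
    have "normal_density 0 \<sigma> a = 1 / (r * \<sigma>) * exp (- ((a / \<sigma>)\<^sup>2) / 2)"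
      using assms by (simp add: normal_density_def real_sqrt_mult r_def field_simps)
    then have "(1 / \<sigma>) * (r * exp (- ((a / \<sigma>)\<^sup>2) / 2)) = 2 * pi * normal_density 0 \<sigma> a"
      using assms r(2) unfolding r(1) by simp
    then have "(1 / \<sigma>) * (sqrt (2 * pi) * exp (- ((a / \<sigma>)\<^sup>2) / 2)) = 2 * pi * normal_density 0 \<sigma> a"
      by (simp only: r_def)
    then show ?thesis by (metis of_real_mult scaleR_conv_of_real)
  qed
  finally show ?thesis .
qed

lemma integrable_gauss_energy:
  assumes \<sigma>: "\<sigma> > 0" and z: "integrable lborel z"
  shows "integrable lborel (\<lambda>w. exp (- (\<sigma> * w)\<^sup>2 / 2) * (cmod (fourier z w))\<^sup>2)"
proof (rule Bochner_Integration.integrable_bound)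
  let ?C = "(LINT t|lborel. \<bar>z t\<bar>)"
  show "integrable lborel (\<lambda>w. exp (- (\<sigma> * w)\<^sup>2 / 2) * ?C\<^sup>2)"
    using integrable_gaussian[OF \<sigma>] by simp
  show "(\<lambda>w. exp (- (\<sigma> * w)\<^sup>2 / 2) * (cmod (fourier z w))\<^sup>2) \<in> borel_measurable lborel"
    using z by measurable
  show "AE w in lborel. norm (exp (- (\<sigma> * w)\<^sup>2 / 2) * (cmod (fourier z w))\<^sup>2) \<le> norm (exp (- (\<sigma> * w)\<^sup>2 / 2) * ?C\<^sup>2)"
    using norm_fourier_le[OF z] by (auto intro!: power_mono simp: abs_mult)
qed

text \<open>Writing the squared modulus of the transform as a double integral over \<open>t\<close> and \<open>u\<close> and integrating
over the frequency first leaves the transform of the Gaussian at \<open>u - t\<close>, which is a normal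
density.  The energy is thus \<open>2 * pi\<close> times the correlation of \<open>z\<close> with its mollification.\<close>

lemma gauss_energy_eq:
  assumes \<sigma>: "\<sigma> > 0" and z: "integrable lborel z"
  shows "gauss_energy \<sigma> (fourier z) =
     2 * pi * (LINT t|lborel. z t * (LINT u|lborel. z u * normal_density 0 \<sigma> (u - t)))"
proof -
  define W where "W = (\<lambda>w. exp (- (\<sigma> * w)\<^sup>2 / 2))"
  have W: "integrable lborel W" unfolding W_def by (rule integrable_gaussian[OF \<sigma>])
  note [measurable] = borel_measurable_integrable[OF z] borel_measurable_integrable[OF W]
  have cW: "integrable lborel (\<lambda>w. complex_of_real (W w) * cis (w * c))" for c
    using W by (rule Bochner_Integration.integrable_bound) (auto simp: norm_mult)
  have cWF: "integrable lborel (\<lambda>w. complex_of_real (W w) * cnj (fourier z w))"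
  proof (rule Bochner_Integration.integrable_bound)
    show "integrable lborel (\<lambda>w. W w * (LINT t|lborel. \<bar>z t\<bar>))" using W by simp
    show "(\<lambda>w. complex_of_real (W w) * cnj (fourier z w)) \<in> borel_measurable lborel"
      using z by measurable
    show "AE w in lborel. norm (complex_of_real (W w) * cnj (fourier z w)) \<le> norm (W w * (LINT t|lborel. \<bar>z t\<bar>))"
      using norm_fourier_le[OF z] by (intro AE_I2) (simp add: norm_mult abs_mult mult_left_mono)
  qed
  have cF: "cnj (fourier z w) = (LINT u|lborel. of_real (z u) * cis (w * u))" for w
    unfolding fourier_def Bochner_Integration.integral_cnj[symmetric] by (simp add: cis_cnj)
  have inner: "(LINT w|lborel. (complex_of_real (W w) * cnj (fourier z w)) * cis (- (w * t))) =
     complex_of_real (2 * pi * (LINT u|lborel. z u * normal_density 0 \<sigma> (u - t)))" for t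
  proof -
    have "(LINT w|lborel. (complex_of_real (W w) * cnj (fourier z w)) * cis (- (w * t))) =
       (LINT w|lborel. (complex_of_real (W w) * cis (w * (- t))) * (LINT u|lborel. of_real (z u) * cis (w * u)))"
      by (simp add: cF mult_ac)
    also have "\<dots> = (LINT u|lborel. of_real (z u) * (LINT w|lborel. (complex_of_real (W w) * cis (w * (- t))) * cis (w * u)))"
      by (rule swap_integrals_bounded[OF cW z]) auto
    also have "\<dots> = (LINT u|lborel. of_real (z u) * (LINT w|lborel. complex_of_real (W w) * cis (w * (u - t))))"
      by (simp add: mult.assoc cis_mult algebra_simps)
    also have "\<dots> = (LINT u|lborel. complex_of_real (z u * (2 * pi * normal_density 0 \<sigma> (u - t))))"
      using fourier_gaussian[OF \<sigma>] by (simp add: W_def)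
    also have "\<dots> = complex_of_real (LINT u|lborel. (2 * pi) * (z u * normal_density 0 \<sigma> (u - t)))"
      by (subst integral_complex_of_real[symmetric]) (simp add: mult_ac)
    finally show ?thesis by simp
  qed
  have "complex_of_real (gauss_energy \<sigma> (fourier z)) =
      (LINT w|lborel. complex_of_real (W w * (cmod (fourier z w))\<^sup>2))"
    unfolding gauss_energy_def W_def by (rule integral_complex_of_real[symmetric])
  also have "\<dots> = (LINT w|lborel. (complex_of_real (W w) * cnj (fourier z w)) * (LINT t|lborel. of_real (z t) * cis (- (w * t))))"
    by (rule Bochner_Integration.integral_cong[OF refl])
       (simp only: fourier_def[symmetric] of_real_mult complex_norm_square mult_ac)
  also have "\<dots> = (LINT t|lborel. of_real (z t) * (LINT w|lborel. (complex_of_real (W w) * cnj (fourier z w)) * cis (- (w * t))))"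
    by (rule swap_integrals_bounded[OF cWF z]) auto
  also have "\<dots> = (LINT t|lborel. complex_of_real (2 * pi * (z t * (LINT u|lborel. z u * normal_density 0 \<sigma> (u - t)))))"
    unfolding inner by (simp add: mult_ac)
  also have "\<dots> = complex_of_real (2 * pi * (LINT t|lborel. z t * (LINT u|lborel. z u * normal_density 0 \<sigma> (u - t))))"
    by (subst integral_complex_of_real) simp
  finally show ?thesis by (simp only: of_real_eq_iff)
qed


lemma integral_translate:
  fixes h :: "real \<Rightarrow> 'a::{banach, second_countable_topology}"
  shows "(LINT u|lborel. h (u - t)) = (LINT u|lborel. h u)"
  using lborel_integral_real_affine[of 1 h "-t"] by simp

lemma integrable_translate:
  fixes h :: "real \<Rightarrow> 'a::{banach, second_countable_topology}"
  assumes "integrable lborel h"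
  shows "integrable lborel (\<lambda>u. h (u - t))"
  using lborel_integrable_real_affine[OF assms, of 1 "-t"] by simp

lemma integrable_convolution:
  fixes g h :: "real \<Rightarrow> 'a::{banach, second_countable_topology, real_normed_field}"
  assumes g: "integrable lborel g" and h: "integrable lborel h"
  shows "integrable (lborel \<Otimes>\<^sub>M lborel) (\<lambda>(t, u). g t * h (u - t))"
proof (rule lborel_pair.Fubini_integrable, goal_cases)
  case 1
  note [measurable] = borel_measurable_integrable[OF g] borel_measurable_integrable[OF h]
  show ?case by measurable
next
  case 2
  show ?case using g integral_translate[of "\<lambda>u. norm (h u)"] by (simp add: norm_mult)
next
  case 3
  show ?case using integrable_translate[OF h] by simp
qed

lemma integral_convolution:
  fixes g h :: "real \<Rightarrow> 'a::{banach, second_countable_topology, real_normed_field}"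
  assumes g: "integrable lborel g" and h: "integrable lborel h"
  shows "(LINT u|lborel. (LINT t|lborel. g t * h (u - t))) = integral\<^sup>L lborel g * integral\<^sup>L lborel h"
  using lborel_pair.Fubini_integral[OF integrable_convolution[OF g h]] by (simp add: integral_translate)

text \<open>The upper half of Plancherel's identity holds for every \<open>\<sigma>\<close>: estimate \<open>z t * z u\<close> by
\<open>((z t)\<^sup>2 + (z u)\<^sup>2) / 2\<close> and use that the density integrates to \<open>1\<close> in either variable.\<close>

lemma gauss_energy_le:
  assumes \<sigma>: "\<sigma> > 0" and z: "integrable lborel z" and z2: "integrable lborel (\<lambda>t. (z t)\<^sup>2)"
  shows "gauss_energy \<sigma> (fourier z) \<le> 2 * pi * (LINT t|lborel. (z t)\<^sup>2)"
proof -
  note [measurable] = borel_measurable_integrable[OF z]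
  let ?n = "normal_density 0 \<sigma>" and ?P = "lborel \<Otimes>\<^sub>M lborel :: (real \<times> real) measure"
  have n: "integrable lborel ?n" "integral\<^sup>L lborel ?n = 1" using \<sigma> by auto
  have n_minus: "?n (t - u) = ?n (u - t)" for t u
    by (simp add: normal_density_def power2_commute)
  have i1: "integrable ?P (\<lambda>(t, u). (z t)\<^sup>2 * ?n (u - t))"
    by (rule integrable_convolution[OF z2 n(1)])
  have i2: "integrable ?P (\<lambda>(t, u). (z u)\<^sup>2 * ?n (u - t))"
    using lborel_pair.integrable_product_swap[OF i1] by (simp add: case_prod_unfold n_minus)
  have v1: "(LINT p|?P. (case p of (t, u) \<Rightarrow> (z t)\<^sup>2 * ?n (u - t))) = (LINT t|lborel. (z t)\<^sup>2)"
    using lborel_pair.integral_fst'[OF i1] by (simp add: integral_translate n)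
  have v2: "(LINT p|?P. (case p of (t, u) \<Rightarrow> (z u)\<^sup>2 * ?n (u - t))) = (LINT t|lborel. (z t)\<^sup>2)"
    using lborel_pair.integral_product_swap[OF borel_measurable_integrable[OF i1]]
    unfolding v1[symmetric] by (simp add: case_prod_unfold n_minus)
  let ?B = "\<lambda>(t, u). (z t)\<^sup>2 * ?n (u - t) / 2 + (z u)\<^sup>2 * ?n (u - t) / 2"
  have iB: "integrable ?P ?B"
    using i1 i2 by (simp add: case_prod_unfold)
  have le: "\<bar>z t * (z u * ?n (u - t))\<bar> \<le> (z t)\<^sup>2 * ?n (u - t) / 2 + (z u)\<^sup>2 * ?n (u - t) / 2" for t u
  proof -
    have "\<bar>z t\<bar> * \<bar>z u\<bar> \<le> ((z t)\<^sup>2 + (z u)\<^sup>2) / 2"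
      using sum_squares_bound[of "\<bar>z t\<bar>" "\<bar>z u\<bar>"] by simp
    from mult_right_mono[OF this normal_density_nonneg[of 0 \<sigma> "u - t"]] show ?thesis
      by (simp add: abs_mult field_simps)
  qed
  have iZ: "integrable ?P (\<lambda>(t, u). z t * (z u * ?n (u - t)))"
    by (rule Bochner_Integration.integrable_bound[OF iB])
       (auto intro!: order_trans[OF le] abs_ge_self)
  have "(LINT t|lborel. z t * (LINT u|lborel. z u * ?n (u - t))) = (LINT p|?P. (case p of (t, u) \<Rightarrow> z t * (z u * ?n (u - t))))"
    using lborel_pair.integral_fst'[OF iZ] by simp
  also have "\<dots> \<le> integral\<^sup>L ?P ?B"
    by (rule integral_mono[OF iZ iB]) (auto intro: order_trans[OF abs_ge_self le])
  also have "\<dots> = (LINT t|lborel. (z t)\<^sup>2)"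
    using i1 i2 v1 v2 by (simp add: case_prod_unfold)
  finally show ?thesis unfolding gauss_energy_eq[OF \<sigma> z] by simp
qed

text \<open>In the limit equality holds: at a point of continuity the mollifications of \<open>z\<close>
converge to \<open>z\<close>, and boundedness of \<open>z\<close> provides dominating functions for both integrals.\<close>

lemma gauss_energy_tendsto:
  assumes z: "integrable lborel z" and zB: "\<And>t. \<bar>z t\<bar> \<le> B"
    and cont: "AE t in lborel. isCont z t"
  shows "(\<lambda>k. gauss_energy (1 / real (Suc k)) (fourier z)) \<longlonglongrightarrow> 2 * pi * (LINT t|lborel. (z t)\<^sup>2)"
proof -
  note [measurable] = borel_measurable_integrable[OF z]
  define J where "J k t = (LINT v|lborel. z (t + 1 / real (Suc k) * v) * std_normal_density v)" for k t
  have J: "(LINT u|lborel. z u * normal_density 0 (1 / real (Suc k)) (u - t)) = J k t" for k t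
  proof -
    define s where "s = 1 / real (Suc k)"
    have s: "s > 0" by (simp add: s_def)
    have eq: "normal_density 0 s (s * v) = std_normal_density v / s" for v
      using s by (simp add: normal_density_def real_sqrt_mult power_mult_distrib)
    show ?thesis
      unfolding J_def s_def[symmetric]
      using lborel_integral_real_affine[of s "\<lambda>u. z u * normal_density 0 s (u - t)" t] s
      by (simp add: eq)
  qed
  have inB: "integrable lborel (\<lambda>v. B * std_normal_density v)" by simp
  have dom: "norm (z (t + 1 / real (Suc k) * v) * std_normal_density v) \<le> B * std_normal_density v" for t k v
    by (simp add: abs_mult mult_right_mono zB)
  have Jlim: "(\<lambda>k. J k t) \<longlonglongrightarrow> z t" if c: "isCont z t" for t
  proof -
    have "(\<lambda>k. J k t) \<longlonglongrightarrow> (LINT v|lborel. z t * std_normal_density v)"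
      unfolding J_def
    proof (rule integral_dominated_convergence[OF _ _ inB])
      show "AE v in lborel. (\<lambda>k. z (t + 1 / real (Suc k) * v) * std_normal_density v) \<longlonglongrightarrow> z t * std_normal_density v"
      proof (rule AE_I2)
        fix v :: real
        have "(\<lambda>k. t + 1 / real (Suc k) * v) \<longlonglongrightarrow> t + 0 * v"
          by (intro tendsto_intros LIMSEQ_Suc[OF lim_1_over_n])
        then have "(\<lambda>k. z (t + 1 / real (Suc k) * v)) \<longlonglongrightarrow> z t"
          using isCont_tendsto_compose[OF c] by simp
        then show "(\<lambda>k. z (t + 1 / real (Suc k) * v) * std_normal_density v) \<longlonglongrightarrow> z t * std_normal_density v"
          by (intro tendsto_intros)
      qed
    qed (use dom in auto)
    then show ?thesis by simp
  qed
  have Jbound: "\<bar>J k t\<bar> \<le> B" for k t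
  proof -
    have "\<bar>J k t\<bar> \<le> (LINT v|lborel. B * std_normal_density v)"
      unfolding J_def real_norm_def[symmetric]
    proof (rule Bochner_Integration.integral_norm_bound_integral[OF _ inB])
      show "integrable lborel (\<lambda>v. z (t + 1 / real (Suc k) * v) * std_normal_density v)"
      proof (rule Bochner_Integration.integrable_bound[OF inB])
        show "AE v in lborel. norm (z (t + 1 / real (Suc k) * v) * std_normal_density v) \<le> norm (B * std_normal_density v)"
          by (intro AE_I2 order_trans[OF dom]) simp
      qed measurable
    qed (use dom in auto)
    then show ?thesis by simp
  qed
  have J_meas [measurable]: "J k \<in> borel_measurable borel" for k
    unfolding J_def by measurable
  have "(\<lambda>k. LINT t|lborel. z t * J k t) \<longlonglongrightarrow> (LINT t|lborel. z t * z t)"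
  proof (rule integral_dominated_convergence)
    show "integrable lborel (\<lambda>t. \<bar>z t\<bar> * B)" using z by simp
    show "AE t in lborel. (\<lambda>k. z t * J k t) \<longlonglongrightarrow> z t * z t"
      using cont by eventually_elim (intro tendsto_intros Jlim)
    show "AE t in lborel. norm (z t * J k t) \<le> \<bar>z t\<bar> * B" for k
      by (intro AE_I2) (simp add: abs_mult mult_left_mono Jbound)
  qed auto
  moreover have "gauss_energy (1 / real (Suc k)) (fourier z) = 2 * pi * (LINT t|lborel. z t * J k t)" for k
    by (subst gauss_energy_eq[OF _ z]) (simp_all only: J of_nat_0_less_iff zero_less_divide_1_iff zero_less_Suc)
  ultimately show ?thesis
    by (simp only: power2_eq_square tendsto_mult_left)
qed

section \<open>Gamma integrals with a complex rate\<close>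

lemma has_bochner_integral_gamma_real:
  fixes a r :: real
  assumes a: "a > 0" and r: "r > 0"
  shows "has_bochner_integral lborel (\<lambda>u. indicator {0..} u * (u powr (a - 1) * exp (- (r * u)))) (Gamma a * r powr (- a))"
proof -
  have "has_bochner_integral lborel (\<lambda>u. indicator {0..} u * u powr (a - 1) / exp u) (Gamma a)"
    by (rule has_bochner_integral_nn_integral)
       (use Gamma_conv_nn_integral_real[OF a] Gamma_real_pos[OF a] in \<open>auto simp: less_imp_le\<close>)
  then have "has_bochner_integral lborel (\<lambda>u. indicator {0..} (r * u) * (r * u) powr (a - 1) / exp (r * u)) (Gamma a / r)"
    using lborel_has_bochner_integral_real_affine_iff[of r "\<lambda>u. indicator {0..} u * u powr (a - 1) / exp u" "Gamma a" 0] r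
    by (simp add: field_simps)
  then have "has_bochner_integral lborel (\<lambda>u. r powr (1 - a) * (indicator {0..} (r * u) * (r * u) powr (a - 1) / exp (r * u))) (r powr (1 - a) * (Gamma a / r))"
    by (rule has_bochner_integral_mult_right)
  moreover have "r powr (1 - a) * (indicator {0..} (r * u) * (r * u) powr (a - 1) / exp (r * u)) =
      indicator {0..} u * (u powr (a - 1) * exp (- (r * u)))" for u
  proof -
    have "r powr (1 - a) * r powr (a - 1) = 1" using r by (simp add: powr_add[symmetric])
    then show ?thesis using r
      by (auto simp: indicator_def powr_mult exp_minus field_simps zero_le_mult_iff)
  qed
  moreover have "r powr (1 - a) * (Gamma a / r) = Gamma a * r powr (- a)"
    using r by (simp add: powr_diff powr_minus field_simps)
  ultimately show ?thesis by simp
qed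

text \<open>Euler's integral along a complex rate \<open>s\<close>.  Put \<open>s = r - w\<close> with \<open>r\<close> real and expand \<open>exp (w * u)\<close>:
integrating term by term gives real Gamma integrals, and the resulting series is the binomial
series of \<open>(1 - w / r) powr (- a)\<close>.  It converges absolutely as soon as \<open>cmod w < r\<close>, and every
\<open>s\<close> in the right half plane satisfies this for \<open>r\<close> large enough.\<close>

lemma has_bochner_integral_gamma_complex:
  fixes a :: real and s :: complex
  assumes a: "a > 0" and s: "Re s > 0"
  shows "has_bochner_integral lborel
     (\<lambda>u. complex_of_real (indicator {0..} u * u powr (a - 1)) * exp (- (s * of_real u)))
     (of_real (Gamma a) * s powr (- of_real a))"
proof -
  \<comment> \<open>The condition \<open>cmod w < r\<close> amounts to \<open>r > (cmod s)\<^sup>2 / (2 * Re s)\<close>.\<close>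
  define r where "r = (cmod s)\<^sup>2 / Re s"
  define w where "w = of_real r - s"
  have s0: "s \<noteq> 0" using s by auto
  have r: "r > 0" using s s0 by (simp add: r_def)
  have wr: "cmod w < r"
  proof (rule power_less_imp_less_base)
    have rs: "r * Re s = (cmod s)\<^sup>2" using s by (simp add: r_def)
    have "(cmod w)\<^sup>2 = r\<^sup>2 - 2 * (r * Re s) + (cmod s)\<^sup>2"
      unfolding w_def cmod_power2 by (simp add: power2_eq_square algebra_simps)
    also have "\<dots> = r\<^sup>2 - (cmod s)\<^sup>2" using rs by simp
    finally show "(cmod w)\<^sup>2 < r\<^sup>2" using s0 by simp
  qed (use r in simp)
  define g where "g b u = indicator {0..} u * (u powr (b - 1) * exp (- (r * u)))" for b u :: real
  have g: "has_bochner_integral lborel (g b) (Gamma b * r powr (- b))" if "b > 0" for b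
    unfolding g_def by (rule has_bochner_integral_gamma_real[OF that r])
  define c where "c n = w ^ n / fact n" for n
  define f where "f n u = c n * complex_of_real (g (a + n) u)" for n u
  have an: "a + real n > 0" for n using a by simp
  have f: "has_bochner_integral lborel (f n) (c n * of_real (Gamma (a + n) * r powr (- (a + n))))" for n
    unfolding f_def by (intro has_bochner_integral_mult_right has_bochner_integral_of_real g an)
  have nf: "has_bochner_integral lborel (\<lambda>u. norm (f n u)) (cmod (c n) * (Gamma (a + n) * r powr (- (a + n))))" for n
  proof -
    have "norm (f n u) = cmod (c n) * g (a + n) u" for u
      by (simp add: f_def norm_mult g_def)
    then show ?thesis using has_bochner_integral_mult_right[OF g[OF an]] by (simp only:)
  qed
  have coeff: "Gamma (a + n) * r powr (- (a + n)) / fact n = Gamma a * r powr (- a) * (((- a) gchoose n) * (- 1 / r) ^ n)" for n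
  proof -
    have "Gamma (a + n) = pochhammer a n * Gamma a"
    proof -
      have "a \<notin> \<int>\<^sub>\<le>\<^sub>0" using nonpos_Ints_nonpos[of a] a by linarith
      from pochhammer_Gamma[OF this, of n] Gamma_real_pos[OF a] show ?thesis by simp
    qed
    moreover have "r powr (- (a + n)) = r powr (- a) / r ^ n"
      using r by (simp add: powr_diff powr_realpow)
    moreover have "((- a) gchoose n) * (- 1 / r) ^ n = pochhammer a n / fact n * (1 / r ^ n)"
    proof -
      have "(- 1) ^ n * (- 1 / r) ^ n = 1 / r ^ n"
        by (simp add: power_mult_distrib[symmetric] power_one_over)
      moreover have "((- a) gchoose n) * (- 1 / r) ^ n = pochhammer a n / fact n * ((- 1) ^ n * (- 1 / r) ^ n)"
        by (simp add: gbinomial_pochhammer)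
      ultimately show ?thesis by (simp only:)
    qed
    ultimately show ?thesis by (simp add: mult_ac)
  qed
  have "summable (\<lambda>n. ((- a) gchoose n) * (- cmod w / r) ^ n)"
    using gen_binomial_real[of "- cmod w / r" "- a"] wr r by (auto simp: sums_iff)
  then have "summable (\<lambda>n. Gamma a * r powr (- a) * (((- a) gchoose n) * (- cmod w / r) ^ n))"
    by (rule summable_mult)
  moreover have "cmod (c n) * (Gamma (a + n) * r powr (- (a + n))) = Gamma a * r powr (- a) * (((- a) gchoose n) * (- cmod w / r) ^ n)" for n
  proof -
    have "cmod (c n) * (Gamma (a + n) * r powr (- (a + n))) = cmod w ^ n * (Gamma (a + n) * r powr (- (a + n)) / fact n)"
      by (simp add: c_def norm_divide norm_power)
    also have "\<dots> = Gamma a * r powr (- a) * (((- a) gchoose n) * (cmod w * (- 1 / r)) ^ n)"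
      unfolding coeff by (simp only: power_mult_distrib mult_ac)
    finally show ?thesis by simp
  qed
  ultimately have sum_int: "summable (\<lambda>n. LINT u|lborel. norm (f n u))"
    using has_bochner_integral_integral_eq[OF nf] by simp
  have fs: "(\<lambda>n. f n u) sums (complex_of_real (indicator {0..} u * u powr (a - 1)) * exp (- (s * of_real u)))"
    and fa: "summable (\<lambda>n. norm (f n u))" for u
  proof -
    have fn: "f n u = of_real (g a u) * ((w * of_real u) ^ n /\<^sub>R fact n)" for n
    proof (cases "u > 0")
      case True
      then have "u powr (a + real n - 1) = u powr (a - 1) * u ^ n"
        by (simp add: powr_add powr_diff powr_realpow)
      then show ?thesis
        by (simp add: f_def g_def c_def power_mult_distrib scaleR_conv_of_real field_simps)
    qed (auto simp: f_def g_def indicator_def)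
    have "(\<lambda>n. f n u) sums (of_real (g a u) * exp (w * of_real u))"
      unfolding fn by (intro sums_mult exp_converges)
    also have "of_real (g a u) * exp (w * of_real u) = complex_of_real (indicator {0..} u * u powr (a - 1)) * exp (- (s * of_real u))"
      by (simp add: g_def w_def algebra_simps exp_of_real[symmetric] exp_add[symmetric])
    finally show "(\<lambda>n. f n u) sums (complex_of_real (indicator {0..} u * u powr (a - 1)) * exp (- (s * of_real u)))" .
    show "summable (\<lambda>n. norm (f n u))"
      unfolding fn norm_mult by (intro summable_mult summable_norm_exp)
  qed
  have fi: "integrable lborel (f n)" for n using f by (simp add: has_bochner_integral_iff)
  have fa': "AE u in lborel. summable (\<lambda>n. norm (f n u))" using fa by simp
  have sumf: "(\<lambda>u. \<Sum>n. f n u) = (\<lambda>u. complex_of_real (indicator {0..} u * u powr (a - 1)) * exp (- (s * of_real u)))"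
    using sums_unique[OF fs] by (simp add: fun_eq_iff)
  have "(\<lambda>n. ((- complex_of_real a) gchoose n) * (- w / r) ^ n) sums (1 + (- w / r)) powr (- complex_of_real a)"
    by (rule gen_binomial_complex) (use wr r in \<open>simp add: norm_divide\<close>)
  then have "(\<lambda>n. of_real (Gamma a * r powr (- a)) * (((- complex_of_real a) gchoose n) * (- w / r) ^ n)) sums
     (of_real (Gamma a * r powr (- a)) * (1 + (- w / r)) powr (- complex_of_real a))"
    by (rule sums_mult)
  moreover have "of_real (Gamma a * r powr (- a)) * (((- complex_of_real a) gchoose n) * (- w / r) ^ n) = integral\<^sup>L lborel (f n)" for n
  proof -
    have "integral\<^sup>L lborel (f n) = c n * of_real (Gamma (a + n) * r powr (- (a + n)))"
      by (rule has_bochner_integral_integral_eq[OF f])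
    also have "\<dots> = w ^ n * of_real (Gamma (a + n) * r powr (- (a + n)) / fact n)"
      by (simp add: c_def)
    also have "\<dots> = of_real (Gamma a * r powr (- a)) * (of_real ((- a) gchoose n) * (w * of_real (- 1 / r)) ^ n)"
      unfolding coeff by (simp only: power_mult_distrib of_real_mult of_real_power mult_ac)
    also have "complex_of_real ((- a) gchoose n) = ((- complex_of_real a) gchoose n)"
      by (simp add: gbinomial_pochhammer pochhammer_of_real[symmetric])
    also have "w * of_real (- 1 / r) = - w / r" by simp
    finally show ?thesis by (simp only:)
  qed
  moreover have "of_real (Gamma a * r powr (- a)) * (1 + (- w / r)) powr (- complex_of_real a) = of_real (Gamma a) * s powr (- of_real a)"
  proof -
    have eq: "1 + (- w / r) = s / r" using r by (simp add: w_def field_simps)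
    have "Ln s = of_real (ln r) + Ln (s / r)"
      using Ln_times_of_real[of r "s / r"] r s0 by (simp add: Ln_of_real)
    then have "s powr (- of_real a) = exp (- of_real a * (of_real (ln r) + Ln (s / r)))"
      using s0 by (simp only: powr_def if_False)
    also have "\<dots> = exp (of_real (- a * ln r)) * exp (- of_real a * Ln (s / r))"
      by (simp only: distrib_left exp_add of_real_mult of_real_minus)
    also have "exp (complex_of_real (- a * ln r)) = of_real (r powr (- a))"
      using r by (simp only: powr_def exp_of_real) simp
    also have "exp (- of_real a * Ln (s / r)) = (s / r) powr (- complex_of_real a)"
      using s0 r by (simp add: powr_def)
    finally have "s powr (- of_real a) = of_real (r powr (- a)) * (s / r) powr (- complex_of_real a)" .
    then show ?thesis unfolding eq by simp
  qed
  ultimately have "(\<lambda>n. integral\<^sup>L lborel (f n)) sums (of_real (Gamma a) * s powr (- of_real a))"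
    by (simp only:)
  then have "integral\<^sup>L lborel (\<lambda>u. \<Sum>n. f n u) = of_real (Gamma a) * s powr (- of_real a)"
    using sums_integral[OF fi fa' sum_int] sums_unique2 by blast
  then show ?thesis
    using integrable_suminf[OF fi fa' sum_int] unfolding sumf by (simp add: has_bochner_integral_iff)
qed

section \<open>Laplace transforms of Volterra equations\<close>

lemma measurable_halfline:
  fixes y :: "real \<Rightarrow> real"
  assumes "continuous_on {0..} y"
  shows "(\<lambda>t. indicator {0..} t * y t) \<in> borel_measurable borel"
  using borel_measurable_continuous_on_indicator[OF _ assms] by simp

text \<open>This is the case \<open>a = 1\<close> of the Gamma integral, except at the single point \<open>0\<close>, where
\<open>0 powr 0 = 0\<close>.\<close>

lemma has_bochner_integral_exp_complex:
  assumes s: "Re s > 0"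
  shows "has_bochner_integral lborel
     (\<lambda>t. complex_of_real (indicator {0..} t) * exp (- (s * of_real t))) (1 / s)"
proof -
  have "has_bochner_integral lborel
     (\<lambda>t. complex_of_real (indicator {0..} t * t powr (1 - 1)) * exp (- (s * of_real t))) (1 / s)"
    using has_bochner_integral_gamma_complex[OF zero_less_one s] s
    by (auto simp: powr_minus field_simps)
  moreover have "AE t in lborel. complex_of_real (indicator {0..} t * t powr (1 - 1)) * exp (- (s * of_real t)) =
     complex_of_real (indicator {0..} t) * exp (- (s * of_real t))"
    using AE_lborel_singleton[of "0::real"] by eventually_elim auto
  ultimately show ?thesis
    by (subst (asm) has_bochner_integral_cong_AE) auto
qed

lemma integrable_exp_halfline:
  assumes "c > (0::real)"
  shows "integrable lborel (\<lambda>t. indicator {0..} t * exp (- (c * t)))"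
    and "(LINT t|lborel. indicator {0..} t * exp (- (c * t))) = 1 / c"
proof -
  have "has_bochner_integral lborel (\<lambda>t. indicator {0..} t * exp (- (c * t))) (1 / c)"
    using has_bochner_integral_Re[OF has_bochner_integral_exp_complex[of "of_real c"]] assms
    by (simp add: exp_of_real flip: of_real_mult of_real_minus)
  then show "integrable lborel (\<lambda>t. indicator {0..} t * exp (- (c * t)))"
    and "(LINT t|lborel. indicator {0..} t * exp (- (c * t))) = 1 / c"
    by (auto simp: has_bochner_integral_iff)
qed

definition laplace :: "(real \<Rightarrow> real) \<Rightarrow> complex \<Rightarrow> complex" where
  "laplace y s = (LINT t|lborel. complex_of_real (indicator {0..} t * y t) * exp (- (s * of_real t)))"

text \<open>On the vertical line \<open>Re s = c\<close> the Laplace transform of \<open>y\<close> is the Fourier transform of this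
function, which is how Plancherel's identity enters.\<close>

definition damped :: "real \<Rightarrow> (real \<Rightarrow> real) \<Rightarrow> real \<Rightarrow> real" where
  "damped c y t = indicator {0..} t * exp (- (c * t)) * y t"

lemma measurable_damped [measurable]:
  assumes "continuous_on {0..} y"
  shows "damped c y \<in> borel_measurable borel"
proof -
  have [measurable]: "(\<lambda>t. indicator {0..} t * y t) \<in> borel_measurable borel"
    by (rule measurable_halfline[OF assms])
  have "damped c y = (\<lambda>t. exp (- (c * t)) * (indicator {0..} t * y t))"
    by (auto simp: damped_def)
  then show ?thesis by simp
qed

lemma abs_damped_le:
  assumes "\<And>t. t \<ge> 0 \<Longrightarrow> \<bar>y t\<bar> \<le> B"
  shows "\<bar>damped c y t\<bar> \<le> B * (indicator {0..} t * exp (- (c * t)))"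
  using assms by (auto simp: damped_def abs_mult indicator_def mult_right_mono)

lemma integrable_damped:
  assumes "continuous_on {0..} y" "\<And>t. t \<ge> 0 \<Longrightarrow> \<bar>y t\<bar> \<le> B" "c > 0"
  shows "integrable lborel (damped c y)"
proof (rule Bochner_Integration.integrable_bound)
  show "integrable lborel (\<lambda>t. B * (indicator {0..} t * exp (- (c * t))))"
    using integrable_exp_halfline[OF assms(3)] by simp
  show "AE t in lborel. norm (damped c y t) \<le> norm (B * (indicator {0..} t * exp (- (c * t))))"
    using abs_damped_le[OF assms(2)] by (intro AE_I2) (simp add: order_trans[OF _ abs_ge_self])
qed (use assms(1) in simp)

lemma damped_square: "(damped c y t)\<^sup>2 = damped (2 * c) (\<lambda>t. (y t)\<^sup>2) t"
  by (auto simp: damped_def power2_eq_square indicator_def exp_add[symmetric] algebra_simps)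

lemma integrable_damped_square:
  assumes "continuous_on {0..} y" "\<And>t. t \<ge> 0 \<Longrightarrow> \<bar>y t\<bar> \<le> B" "c > 0"
  shows "integrable lborel (\<lambda>t. (damped c y t)\<^sup>2)"
  unfolding damped_square
proof (rule integrable_damped)
  show "continuous_on {0..} (\<lambda>t. (y t)\<^sup>2)" using assms(1) by (intro continuous_intros)
  show "\<bar>(y t)\<^sup>2\<bar> \<le> B\<^sup>2" if "t \<ge> 0" for t using assms(2)[OF that] by (simp add: abs_le_square_iff[symmetric])
qed (use assms in simp)

lemma AE_isCont_damped:
  assumes "continuous_on {0..} y"
  shows "AE t in lborel. isCont (damped c y) t"
  using AE_lborel_singleton[of "0::real"]
proof eventually_elim
  case (elim t)
  show ?case
  proof (cases "t < 0")
    case True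
    have "eventually (\<lambda>u. u < 0) (nhds t)" using eventually_nhds_in_open[of "{..<0::real}" t] True by simp
    then have "eventually (\<lambda>u. damped c y u = 0) (nhds t)"
      by eventually_elim (simp add: damped_def)
    then show ?thesis by (subst isCont_cong) auto
  next
    case False
    with elim have t: "t > 0" by simp
    have "eventually (\<lambda>u. u > 0) (nhds t)" using eventually_nhds_in_open[of "{0::real<..}" t] t by simp
    then have "eventually (\<lambda>u. damped c y u = exp (- (c * u)) * y u) (nhds t)"
      by eventually_elim (simp add: damped_def)
    moreover have "isCont y t"
      using continuous_on_interior[OF assms, of t] t by (simp add: interior_real_atLeast)
    then have "isCont (\<lambda>u. exp (- (c * u)) * y u) t" by (intro continuous_intros)
    ultimately show ?thesis by (subst isCont_cong) auto
  qed
qed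

lemma laplace_eq_fourier: "laplace y (Complex c w) = fourier (damped c y) w"
proof -
  have "complex_of_real (indicator {0..} t * y t) * exp (- (Complex c w * of_real t)) =
     of_real (damped c y t) * cis (- (w * t))" for t
  proof -
    have "exp (- (Complex c w * of_real t)) = of_real (exp (- (c * t))) * cis (- (w * t))"
      by (simp add: exp_eq_polar)
    then show ?thesis by (simp add: damped_def)
  qed
  then show ?thesis unfolding laplace_def fourier_def by simp
qed

lemma integrable_laplace:
  assumes "continuous_on {0..} y" "\<And>t. t \<ge> 0 \<Longrightarrow> \<bar>y t\<bar> \<le> B" and s: "Re s > 0"
  shows "integrable lborel (\<lambda>t. complex_of_real (indicator {0..} t * y t) * exp (- (s * of_real t)))"
proof (rule Bochner_Integration.integrable_bound[OF integrable_damped[OF assms]])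
  have [measurable]: "(\<lambda>t. indicator {0..} t * y t) \<in> borel_measurable borel"
    by (rule measurable_halfline[OF assms(1)])
  show "(\<lambda>t. complex_of_real (indicator {0..} t * y t) * exp (- (s * of_real t))) \<in> borel_measurable lborel"
    by measurable
qed (auto simp: damped_def norm_mult abs_mult)

lemma norm_laplace_le:
  "cmod (laplace y s) \<le> (LINT t|lborel. \<bar>damped (Re s) y t\<bar>)"
  unfolding laplace_def
  by (rule order_trans[OF integral_norm_bound]) (simp add: damped_def norm_mult abs_mult mult_ac)

text \<open>The fractional integral is a convolution with a power function, whose Laplace transform is a Gamma
integral.  Fubini's theorem also yields the integrability of the convolution integrand for almost
every \<open>u\<close>, which suffices to identify the gauge integral inside the Riemann--Liouville integral with
a Lebesgue integral.\<close>

lemma laplace_volterra: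
  fixes y h :: "real \<Rightarrow> real"
  assumes \<alpha>: "\<alpha> > 0" and s: "Re s > 0"
    and y: "continuous_on {0..} y" "\<And>t. t \<ge> 0 \<Longrightarrow> \<bar>y t\<bar> \<le> B"
    and h: "continuous_on {0..} h" "\<And>t. t \<ge> 0 \<Longrightarrow> \<bar>h t\<bar> \<le> C"
    and eq: "\<And>t. t \<ge> 0 \<Longrightarrow> y t = y0 + RL_integral \<alpha> h t"
  shows "laplace y s = of_real y0 / s + s powr (- of_real \<alpha>) * laplace h s"
proof -
  define K where "K u = complex_of_real (indicator {0..} u * u powr (\<alpha> - 1)) * exp (- (s * of_real u))" for u
  define H where "H t = complex_of_real (indicator {0..} t * h t) * exp (- (s * of_real t))" for t
  have K: "integrable lborel K" "integral\<^sup>L lborel K = of_real (Gamma \<alpha>) * s powr (- of_real \<alpha>)"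
    using has_bochner_integral_gamma_complex[OF \<alpha> s] by (simp_all add: K_def[abs_def] has_bochner_integral_iff)
  have H: "integrable lborel H" "integral\<^sup>L lborel H = laplace h s"
    using integrable_laplace[OF h s] by (simp_all add: H_def[abs_def] laplace_def)
  have G: "Gamma \<alpha> > 0" using \<alpha> by (rule Gamma_real_pos)
  let ?E = "\<lambda>u. exp (- (s * complex_of_real u))"
  have AE1: "AE u in lborel. (LINT t|lborel. H t * K (u - t)) =
     of_real (Gamma \<alpha>) * (complex_of_real (indicator {0..} u * y u) * ?E u - of_real y0 * (complex_of_real (indicator {0..} u) * ?E u))"
    using lborel_pair.AE_integrable_snd[OF integrable_convolution[OF H(1) K(1)]]
  proof eventually_elim
    case (elim u)
    define p where "p t = (u - t) powr (\<alpha> - 1) * h t" for t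
    have HK: "H t * K (u - t) = ?E u * complex_of_real (indicator {0..u} t * p t)" for t
      by (auto simp: H_def K_def p_def indicator_def exp_add[symmetric] algebra_simps)
    have "integrable lborel (\<lambda>t. Re (exp (s * complex_of_real u) * (H t * K (u - t))))"
      using elim by (intro integrable_Re integrable_mult_right) simp
    moreover have "Re (exp (s * complex_of_real u) * (H t * K (u - t))) = indicator {0..u} t * p t" for t
      unfolding HK mult.assoc[symmetric] exp_add[symmetric] by simp
    ultimately have p: "set_integrable lborel {0..u} p"
      unfolding set_integrable_def by simp
    have "(LINT t|lborel. H t * K (u - t)) = ?E u * complex_of_real (LINT t:{0..u}|lborel. p t)"
      unfolding HK set_lebesgue_integral_def by (simp del: of_real_mult)
    also have "(LINT t:{0..u}|lborel. p t) = integral {0..u} p"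
      by (rule set_borel_integral_eq_integral(2)[OF p])
    also have "\<dots> = Gamma \<alpha> * (indicator {0..} u * y u - y0 * indicator {0..} u)"
    proof (cases "u \<ge> 0")
      case True
      then show ?thesis using eq[OF True] G by (simp add: RL_integral_def p_def[abs_def])
    qed simp
    finally show ?case by (simp add: algebra_simps)
  qed
  have "of_real (Gamma \<alpha>) * (s powr (- of_real \<alpha>) * laplace h s) = (LINT u|lborel. (LINT t|lborel. H t * K (u - t)))"
    using integral_convolution[OF H(1) K(1)] by (simp add: H K mult_ac)
  also have "\<dots> = (LINT u|lborel. of_real (Gamma \<alpha>) * (complex_of_real (indicator {0..} u * y u) * ?E u - of_real y0 * (complex_of_real (indicator {0..} u) * ?E u)))"
  proof (rule integral_cong_AE[OF _ _ AE1])
    show "(\<lambda>u. LINT t|lborel. H t * K (u - t)) \<in> borel_measurable lborel"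
      using borel_measurable_integrable[OF H(1)] borel_measurable_integrable[OF K(1)] by measurable
    show "(\<lambda>u. of_real (Gamma \<alpha>) * (complex_of_real (indicator {0..} u * y u) * ?E u - of_real y0 * (complex_of_real (indicator {0..} u) * ?E u))) \<in> borel_measurable lborel"
      using measurable_halfline[OF y(1)] by measurable
  qed
  also have "\<dots> = of_real (Gamma \<alpha>) * (laplace y s - of_real y0 * (1 / s))"
    using has_bochner_integral_exp_complex[OF s] integrable_laplace[OF y s]
    unfolding laplace_def integral_mult_right_zero
    by (subst Bochner_Integration.integral_diff) (simp_all add: has_bochner_integral_iff)
  finally have "s powr (- of_real \<alpha>) * laplace h s = laplace y s - of_real y0 * (1 / s)"
    unfolding mult_cancel_left using G by simp
  then show ?thesis by (simp add: algebra_simps)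
qed

section \<open>Eigenvalues and uniform injectivity\<close>

lemma norm_vector_smult: "norm (c *s v) = cmod c * norm (v :: complex ^ 'n)"
  by (simp add: norm_vec_def norm_mult L2_set_right_distrib)

lemma matrix_bound:
  fixes B :: "complex ^ 'n ^ 'n"
  obtains K where "K > 0" "\<And>v. norm (B *v v) \<le> K * norm v"
proof -
  have "linear ((*v) B)"
    by (rule linearI)
      (simp_all add: matrix_vector_right_distrib vec_eq_iff matrix_vector_mult_def scaleR_sum_right
        sum.distrib distrib_left)
  from linear_bounded_pos[OF this] show ?thesis using that by (metis mult.commute)
qed

lemma singular_iff_kernel:
  fixes M :: "complex ^ 'n ^ 'n"
  shows "det M = 0 \<longleftrightarrow> (\<exists>v. v \<noteq> 0 \<and> M *v v = 0)"
  using invertible_det_nz[of M] invertible_left_inverse[of M] matrix_left_invertible_ker[of M] by blast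

lemma mat_minus_mult: "(mat z - B) *v v = z *s v - B *v (v :: complex ^ 'n)"
proof -
  have "mat z *v v = z *s v"
    by (simp add: vec_eq_iff matrix_vector_mult_def mat_def if_distrib if_distribR cong: if_cong)
  then show ?thesis by (simp add: matrix_vector_mult_diff_rdistrib)
qed

lemma eigenvalue_iff_det:
  fixes B :: "complex ^ 'n ^ 'n"
  shows "(\<exists>v. v \<noteq> 0 \<and> B *v v = z *s v) \<longleftrightarrow> det (mat z - B) = 0"
  unfolding singular_iff_kernel mat_minus_mult by (metis right_minus_eq)

text \<open>Expanding the determinant shows that the eigenvalues are the roots of a polynomial.  It does not
vanish identically, since eigenvalues are bounded by the operator bound of the matrix.\<close>

lemma finite_eigenvalues:
  fixes B :: "complex ^ 'n ^ 'n"
  shows "finite {z. \<exists>v. v \<noteq> 0 \<and> B *v v = z *s v}"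
proof -
  define p where "p = (\<Sum>\<pi> | \<pi> permutes (UNIV :: 'n set).
     of_int (sign \<pi>) * (\<Prod>i\<in>UNIV. [: - (B $ i $ \<pi> i), of_bool (i = \<pi> i) :]))"
  have p: "poly p z = det (mat z - B)" for z
    unfolding p_def det_def poly_sum poly_mult poly_prod
    by (intro sum.cong refl arg_cong2[where f="(*)"] prod.cong) (auto simp: mat_def)
  obtain K where K: "K > 0" "\<And>v. norm (B *v v) \<le> K * norm v"
    using matrix_bound[of B] by blast
  have "poly p (of_real (K + 1)) \<noteq> 0"
  proof
    assume "poly p (of_real (K + 1)) = 0"
    then obtain v where v: "v \<noteq> 0" "B *v v = of_real (K + 1) *s v"
      unfolding p eigenvalue_iff_det[symmetric] by blast
    then have "(K + 1) * norm v \<le> K * norm v"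
      using K(2)[of v] K(1) by (simp add: norm_vector_smult del: of_real_add)
    then show False using v(1) by (simp add: distrib_right)
  qed
  then have "p \<noteq> 0" by auto
  then have "finite {z. poly p z = 0}" by (rule poly_roots_finite)
  then show ?thesis unfolding eigenvalue_iff_det p .
qed

lemma left_eigenvector:
  fixes B :: "complex ^ 'n ^ 'n"
  assumes "v \<noteq> 0" "B *v v = z *s v"
  obtains w where "w \<noteq> 0" "\<And>u. (\<Sum>i\<in>UNIV. w $ i * (B *v u) $ i) = z * (\<Sum>i\<in>UNIV. w $ i * u $ i)"
proof -
  have "det (mat z - B) = 0" using assms eigenvalue_iff_det by blast
  then have "det (transpose (mat z - B)) = 0" by simp
  then obtain w where w: "w \<noteq> 0" "transpose (mat z - B) *v w = 0"
    unfolding singular_iff_kernel by blast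
  have col: "(\<Sum>i\<in>UNIV. w $ i * B $ i $ j) = z * w $ j" for j
  proof -
    have "0 = (\<Sum>i\<in>UNIV. (mat z - B) $ i $ j * w $ i)"
      using arg_cong[OF w(2), of "\<lambda>u. u $ j"] by (simp add: matrix_vector_mult_def transpose_def)
    also have "\<dots> = (\<Sum>i\<in>UNIV. (if i = j then z * w $ i else 0) - w $ i * B $ i $ j)"
      by (intro sum.cong) (auto simp: mat_def algebra_simps)
    finally show ?thesis by (simp add: sum_subtractf)
  qed
  have "(\<Sum>i\<in>UNIV. w $ i * (B *v u) $ i) = z * (\<Sum>i\<in>UNIV. w $ i * u $ i)" for u
  proof -
    have "(\<Sum>i\<in>UNIV. w $ i * (B *v u) $ i) = (\<Sum>j\<in>UNIV. \<Sum>i\<in>UNIV. w $ i * B $ i $ j * u $ j)"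
      unfolding matrix_vector_mult_def
      by (simp add: sum_distrib_left mult.assoc) (rule sum.swap)
    also have "\<dots> = (\<Sum>j\<in>UNIV. z * w $ j * u $ j)"
      by (simp add: sum_distrib_right[symmetric] col)
    finally show ?thesis by (simp add: sum_distrib_left mult.assoc)
  qed
  with w(1) show ?thesis using that by blast
qed

text \<open>For large \<open>\<omega>\<close> the perturbation \<open>\<kappa> \<omega> *s (B *v v)\<close> is at most half of \<open>v\<close>.  The remaining
parameters form a compact set, on which, for unit vectors \<open>v\<close>, the norm attains a positive
minimum.\<close>

lemma uniform_injectivity:
  fixes B :: "complex ^ 'n ^ 'n" and \<kappa> :: "real \<Rightarrow> complex"
  assumes cont: "continuous_on UNIV \<kappa>" and lim: "(\<kappa> \<longlongrightarrow> 0) at_infinity"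
    and inj: "\<And>\<omega> v. v = \<kappa> \<omega> *s (B *v v) \<Longrightarrow> v = 0"
  obtains m where "m > 0" "\<And>\<omega> v. m * norm v \<le> norm (v - \<kappa> \<omega> *s (B *v v))"
proof -
  obtain K where K: "K > 0" "\<And>v. norm (B *v v) \<le> K * norm v"
    using matrix_bound[of B] by blast
  have "eventually (\<lambda>\<omega>. cmod (\<kappa> \<omega>) < 1 / (2 * K)) at_infinity"
    using tendstoD[OF lim, of "1 / (2 * K)"] K(1) by simp
  then obtain R where R: "\<And>\<omega>. R \<le> norm \<omega> \<Longrightarrow> cmod (\<kappa> \<omega>) < 1 / (2 * K)"
    unfolding eventually_at_infinity by blast
  have far: "1 / 2 * norm v \<le> norm (v - \<kappa> \<omega> *s (B *v v))" if "R \<le> norm \<omega>" for \<omega> v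
  proof -
    have "norm (\<kappa> \<omega> *s (B *v v)) \<le> 1 / (2 * K) * (K * norm v)"
      unfolding norm_vector_smult using R[OF that] K by (intro mult_mono) auto
    then show ?thesis using norm_triangle_ineq2[of v "\<kappa> \<omega> *s (B *v v)"] K(1) by simp
  qed
  define S where "S = cball (0::real) \<bar>R\<bar> \<times> sphere (0 :: complex ^ 'n) 1"
  define g where "g = (\<lambda>(\<omega>, v). norm (v - \<kappa> \<omega> *s (B *v v)))"
  have "compact S" unfolding S_def by (intro compact_Times) auto
  moreover have "S \<noteq> {}" unfolding S_def by (auto simp: vector_choose_size)
  moreover have "continuous_on S g"
  proof -
    have "continuous_on S (\<lambda>p. \<kappa> (fst p))"
      by (rule continuous_on_compose2[OF cont]) (auto intro: continuous_intros)
    then have "continuous_on S (\<lambda>p. norm (\<chi> i. snd p $ i - \<kappa> (fst p) * (\<Sum>j\<in>UNIV. B $ i $ j * snd p $ j)))"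
      by (intro continuous_intros)
    moreover have "g = (\<lambda>p. norm (\<chi> i. snd p $ i - \<kappa> (fst p) * (\<Sum>j\<in>UNIV. B $ i $ j * snd p $ j)))"
      by (intro ext, unfold g_def case_prod_unfold, rule arg_cong[where f=norm])
         (simp add: vec_eq_iff matrix_vector_mult_def)
    ultimately show ?thesis by (simp only:)
  qed
  ultimately obtain q where q: "q \<in> S" "\<And>p. p \<in> S \<Longrightarrow> g q \<le> g p"
    using continuous_attains_inf by metis
  have gq: "g q > 0"
  proof (cases q)
    case (Pair \<omega> v)
    then have "v \<noteq> 0" using q(1) by (auto simp: S_def)
    then have "v \<noteq> \<kappa> \<omega> *s (B *v v)" using inj by blast
    then show ?thesis using Pair by (simp add: g_def)
  qed
  have near: "g q * norm v \<le> norm (v - \<kappa> \<omega> *s (B *v v))" if "norm \<omega> < R" for \<omega> v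
  proof (cases "v = 0")
    case False
    define u where "u = of_real (inverse (norm v)) *s v"
    have v: "v = of_real (norm v) *s u" using False
      by (simp add: u_def flip: of_real_mult del: of_real_inverse)
    have "norm u = 1" using False by (simp add: u_def norm_vector_smult del: of_real_inverse)
    then have "g q \<le> g (\<omega>, u)" using that by (intro q(2)) (auto simp: S_def)
    moreover have "v - \<kappa> \<omega> *s (B *v v) = of_real (norm v) *s (u - \<kappa> \<omega> *s (B *v u))"
      by (subst (1 2) v) (simp add: vec_eq_iff matrix_vector_mult_def sum_distrib_left algebra_simps)
    then have "norm (v - \<kappa> \<omega> *s (B *v v)) = norm v * g (\<omega>, u)"
      by (simp only: norm_vector_smult norm_of_real abs_norm_cancel g_def case_prod_conv)
    ultimately show ?thesis
      by (simp add: mult.commute mult_left_mono)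
  qed (use gq in simp)
  have "min (1 / 2) (g q) * norm v \<le> norm (v - \<kappa> \<omega> *s (B *v v))" for \<omega> v
  proof (cases "R \<le> norm \<omega>")
    case True
    have "min (1 / 2) (g q) * norm v \<le> 1 / 2 * norm v" by (rule mult_right_mono) auto
    with far[OF True] show ?thesis by (rule order_trans[rotated])
  next
    case False
    have "min (1 / 2) (g q) * norm v \<le> g q * norm v" by (rule mult_right_mono) auto
    with near[of \<omega> v] False show ?thesis by (meson not_le order_trans)
  qed
  then show ?thesis using gq that[of "min (1 / 2) (g q)"] by auto
qed

section \<open>A priori estimates for bounded solutions\<close>

text \<open>The kernel is singular at \<open>\<tau> = t\<close>.  As a dominating function serves the reflected integrand
of the Gamma function; its exponential factor is bounded below on the interval.\<close>

lemma RL_kernel_integrable: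
  fixes F :: "real \<Rightarrow> 'a::euclidean_space"
  assumes \<alpha>: "\<alpha> > 0" and t: "t \<ge> 0" and F: "continuous_on {0..t} F"
  shows "(\<lambda>\<tau>. (t - \<tau>) powr (\<alpha> - 1) *\<^sub>R F \<tau>) integrable_on {0..t}"
proof (rule set_borel_integral_eq_integral(1))
  obtain C where C: "\<And>\<tau>. \<tau> \<in> {0..t} \<Longrightarrow> norm (F \<tau>) \<le> C"
    using compact_continuous_image[OF F compact_Icc, THEN compact_imp_bounded]
    unfolding bounded_iff by blast
  define k where "k u = indicator {0..} u * (u powr (\<alpha> - 1) * exp (- (1 * u)))" for u :: real
  have "integrable lborel k"
    using has_bochner_integral_gamma_real[OF \<alpha> zero_less_one] by (simp add: k_def[abs_def] has_bochner_integral_iff)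
  then have k: "integrable lborel (\<lambda>\<tau>. C * exp t * k (t - \<tau>))"
    using lborel_integrable_real_affine[of k "-1" t] by simp
  have [measurable]: "(\<lambda>\<tau>. indicator {0..t} \<tau> *\<^sub>R F \<tau>) \<in> borel_measurable borel"
    using borel_measurable_continuous_on_indicator[OF _ F] by simp
  show "set_integrable lborel {0..t} (\<lambda>\<tau>. (t - \<tau>) powr (\<alpha> - 1) *\<^sub>R F \<tau>)"
    unfolding set_integrable_def
  proof (rule Bochner_Integration.integrable_bound[OF k])
    have "(\<lambda>\<tau>. (t - \<tau>) powr (\<alpha> - 1) *\<^sub>R (indicator {0..t} \<tau> *\<^sub>R F \<tau>)) \<in> borel_measurable borel"
      by measurable
    then show "(\<lambda>\<tau>. indicator {0..t} \<tau> *\<^sub>R (t - \<tau>) powr (\<alpha> - 1) *\<^sub>R F \<tau>) \<in> borel_measurable lborel"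
      by (simp add: mult.commute)
    have "norm (indicator {0..t} \<tau> *\<^sub>R (t - \<tau>) powr (\<alpha> - 1) *\<^sub>R F \<tau>) \<le> C * exp t * k (t - \<tau>)" for \<tau>
    proof (cases "\<tau> \<in> {0..t}")
      case True
      have "1 * norm (F \<tau>) \<le> (exp t * exp (- (t - \<tau>))) * C"
        using C[OF True] True norm_ge_zero[of "F \<tau>"]
        by (intro mult_mono) (auto simp: exp_add[symmetric])
      from mult_left_mono[OF this, of "(t - \<tau>) powr (\<alpha> - 1)"] show ?thesis
        using True by (simp add: k_def mult_ac)
    next
      case False
      have "C * exp t * k (t - \<tau>) \<ge> 0"
        using order_trans[OF norm_ge_zero C[of 0]] t by (simp add: k_def)
      then show ?thesis using False by simp
    qed
    then show "AE \<tau> in lborel. norm (indicator {0..t} \<tau> *\<^sub>R (t - \<tau>) powr (\<alpha> - 1) *\<^sub>R F \<tau>) \<le> norm (C * exp t * k (t - \<tau>))"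
      by (intro AE_I2) (metis abs_ge_self order_trans real_norm_def)
  qed
qed

lemma RL_integral_component:
  fixes F :: "real \<Rightarrow> real ^ 'n"
  assumes "\<alpha> > 0" "t \<ge> 0" "continuous_on {0..t} F"
  shows "RL_integral \<alpha> F t $ i = RL_integral \<alpha> (\<lambda>\<tau>. F \<tau> $ i) t"
  using integral_component_eq_cart[OF RL_kernel_integrable[OF assms], of i]
  by (simp add: RL_integral_def)

lemma norm_sq_vec: "(norm (v :: 'a::real_normed_vector ^ 'n))\<^sup>2 = (\<Sum>i\<in>UNIV. (norm (v $ i))\<^sup>2)"
  by (simp add: norm_vec_def L2_set_def sum_nonneg)

definition complexify :: "real ^ 'n \<Rightarrow> complex ^ 'n" where
  "complexify v = (\<chi> i. of_real (v $ i))"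

lemma norm_complexify [simp]: "norm (complexify v) = norm v"
  by (simp add: complexify_def norm_vec_def)

definition vlaplace :: "(real \<Rightarrow> real ^ 'n) \<Rightarrow> complex \<Rightarrow> complex ^ 'n" where
  "vlaplace x s = (\<chi> i. laplace (\<lambda>t. x t $ i) s)"

text \<open>The squared norm of \<open>x\<close> in the weighted space \<open>L\<^sup>2\<close> with weight \<open>exp (- c * t)\<close>.\<close>

definition energy :: "real \<Rightarrow> (real \<Rightarrow> real ^ 'n) \<Rightarrow> real" where
  "energy c x = (\<Sum>i\<in>UNIV. LINT t|lborel. (damped c (\<lambda>t. x t $ i) t)\<^sup>2)"

text \<open>A bounded global solution of the Volterra equation, with the nonlinearity along the solution
regarded as an inhomogeneity \<open>g\<close> that is dominated by the solution itself.\<close>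

locale bounded_solution =
  fixes \<alpha> \<eta> B :: real and A :: "real ^ 'n ^ 'n" and x g :: "real \<Rightarrow> real ^ 'n" and x0 :: "real ^ 'n"
  assumes \<alpha>: "\<alpha> > 0"
    and cont_x: "continuous_on {0..} x" and cont_g: "continuous_on {0..} g"
    and bound: "\<And>t. t \<ge> 0 \<Longrightarrow> norm (x t) \<le> B"
    and small: "\<And>t. t \<ge> 0 \<Longrightarrow> norm (g t) \<le> \<eta> * norm (x t)" and \<eta>: "\<eta> \<ge> 0"
    and volterra: "\<And>t. t \<ge> 0 \<Longrightarrow> x t = x0 + RL_integral \<alpha> (\<lambda>\<tau>. A *v x \<tau> + g \<tau>) t"
begin

lemma cont_components: "continuous_on {0..} (\<lambda>t. x t $ i)" "continuous_on {0..} (\<lambda>t. g t $ i)"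
  using cont_x cont_g by (auto intro: continuous_intros)

lemma bound_components:
  assumes "t \<ge> 0" shows "\<bar>x t $ i\<bar> \<le> B" "\<bar>g t $ i\<bar> \<le> \<eta> * B"
  using component_le_norm_cart[of "x t" i] component_le_norm_cart[of "g t" i] bound[OF assms]
    small[OF assms] mult_left_mono[OF bound[OF assms] \<eta>] by linarith+

lemma laplace_equation:
  assumes s: "Re s > 0"
  shows "vlaplace x s = (1 / s) *s complexify x0 +
     s powr (- of_real \<alpha>) *s (map_matrix of_real A *v vlaplace x s + vlaplace g s)"
proof -
  define F where "F \<tau> = A *v x \<tau> + g \<tau>" for \<tau>
  have cF: "continuous_on {0..} F"
    unfolding F_def by (intro continuous_on_add cont_g linear_continuous_on_compose[OF cont_x matrix_vector_mul_linear])
  have F_i: "F \<tau> $ i = (\<Sum>j\<in>UNIV. A $ i $ j * x \<tau> $ j) + g \<tau> $ i" for \<tau> i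
    by (simp add: F_def matrix_vector_mult_def)
  have F_bound: "\<bar>F t $ i\<bar> \<le> (\<Sum>j\<in>UNIV. \<bar>A $ i $ j\<bar> * B) + \<eta> * B" if "t \<ge> 0" for t i
  proof -
    have "\<bar>\<Sum>j\<in>UNIV. A $ i $ j * x t $ j\<bar> \<le> (\<Sum>j\<in>UNIV. \<bar>A $ i $ j\<bar> * B)"
      by (rule order_trans[OF sum_abs]) (auto simp: abs_mult intro!: sum_mono mult_left_mono bound_components that)
    then show ?thesis using bound_components(2)[OF that, of i] unfolding F_i by linarith
  qed
  have component: "laplace (\<lambda>t. x t $ i) s = of_real (x0 $ i) / s + s powr (- of_real \<alpha>) * laplace (\<lambda>t. F t $ i) s" for i
  proof (rule laplace_volterra[OF \<alpha> s cont_components(1) bound_components(1) _ F_bound])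
    show "continuous_on {0..} (\<lambda>t. F t $ i)" using cF by (intro continuous_intros)
    show "x t $ i = x0 $ i + RL_integral \<alpha> (\<lambda>t. F t $ i) t" if "t \<ge> 0" for t
    proof -
      have "x t $ i = x0 $ i + RL_integral \<alpha> F t $ i"
        using arg_cong[OF volterra[OF that], of "\<lambda>v. v $ i"] by (simp add: F_def[abs_def])
      then show ?thesis
        using RL_integral_component[OF \<alpha> that continuous_on_subset[OF cF], of i] by simp
    qed
  qed
  have laplace_F: "laplace (\<lambda>t. F t $ i) s = (\<Sum>j\<in>UNIV. of_real (A $ i $ j) * laplace (\<lambda>t. x t $ j) s) + laplace (\<lambda>t. g t $ i) s" for i
  proof -
    let ?e = "\<lambda>y t. complex_of_real (indicator {0..} t * y t) * exp (- (s * of_real t))"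
    have ix: "integrable lborel (?e (\<lambda>t. x t $ j))" for j
      by (rule integrable_laplace[OF cont_components(1) bound_components(1) s])
    have ig: "integrable lborel (?e (\<lambda>t. g t $ i))"
      by (rule integrable_laplace[OF cont_components(2) bound_components(2) s])
    have eq: "?e (\<lambda>t. F t $ i) = (\<lambda>t. (\<Sum>j\<in>UNIV. of_real (A $ i $ j) * ?e (\<lambda>t. x t $ j) t) + ?e (\<lambda>t. g t $ i) t)"
      by (simp add: fun_eq_iff F_i algebra_simps sum_distrib_left)
    show ?thesis
      unfolding laplace_def eq using ix ig by (simp only: Bochner_Integration.integral_add
        Bochner_Integration.integrable_sum Bochner_Integration.integral_sum integrable_mult_right integral_mult_right_zero)
  qed
  show ?thesis (is "_ = ?R")
  proof (rule vec_eq_iff[THEN iffD2], rule allI)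
    fix i
    have "?R $ i = of_real (x0 $ i) / s + s powr (- of_real \<alpha>) *
        ((\<Sum>j\<in>UNIV. of_real (A $ i $ j) * laplace (\<lambda>t. x t $ j) s) + laplace (\<lambda>t. g t $ i) s)"
      by (simp add: vlaplace_def complexify_def matrix_vector_mult_def map_matrix_def distrib_left)
    also have "\<dots> = laplace (\<lambda>t. x t $ i) s"
      using component[of i] unfolding laplace_F by (rule sym)
    finally show "vlaplace x s $ i = ?R $ i" by (simp add: vlaplace_def)
  qed
qed

lemma damped_square_integrable:
  assumes "c > 0"
  shows "integrable lborel (\<lambda>t. (damped c (\<lambda>t. x t $ i) t)\<^sup>2)" "integrable lborel (\<lambda>t. (damped c (\<lambda>t. g t $ i) t)\<^sup>2)"
  using integrable_damped_square[OF cont_components(1) bound_components(1) assms]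
    integrable_damped_square[OF cont_components(2) bound_components(2) assms] by auto

lemma energy_nonneg: "energy c x \<ge> 0"
  unfolding energy_def by (intro sum_nonneg integral_nonneg_AE) simp

lemma energy_perturbation_le:
  assumes "c > 0" shows "energy c g \<le> \<eta>\<^sup>2 * energy c x"
proof -
  have "(\<Sum>i\<in>UNIV. (damped c (\<lambda>t. g t $ i) t)\<^sup>2) \<le> \<eta>\<^sup>2 * (\<Sum>i\<in>UNIV. (damped c (\<lambda>t. x t $ i) t)\<^sup>2)" for t
  proof (cases "t \<ge> 0")
    case True
    have "(norm (g t))\<^sup>2 \<le> (\<eta> * norm (x t))\<^sup>2" using small[OF True] by (intro power_mono) auto
    then have "(exp (- (c * t)))\<^sup>2 * (norm (g t))\<^sup>2 \<le> (exp (- (c * t)))\<^sup>2 * (\<eta> * norm (x t))\<^sup>2" by (rule mult_left_mono) simp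
    then show ?thesis using True
      by (simp add: damped_def norm_sq_vec power_mult_distrib sum_distrib_left mult_ac)
  qed (simp add: damped_def)
  then have "(LINT t|lborel. (\<Sum>i\<in>UNIV. (damped c (\<lambda>t. g t $ i) t)\<^sup>2)) \<le> (LINT t|lborel. \<eta>\<^sup>2 * (\<Sum>i\<in>UNIV. (damped c (\<lambda>t. x t $ i) t)\<^sup>2))"
    by (intro integral_mono integrable_mult_right Bochner_Integration.integrable_sum damped_square_integrable assms)
  then show ?thesis
    by (simp add: energy_def Bochner_Integration.integral_sum damped_square_integrable[OF assms])
qed

text \<open>On the line \<open>Re s = c\<close> the Laplace equation can be solved for the transform of \<open>x\<close>, with a bound
that is uniform in the frequency.  The contribution of the initial value is a multiple of
\<open>1 / s\<close>, the transform of the constant \<open>1\<close>, so its energy is estimated like that of \<open>g\<close>.\<close>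

lemma gauss_energy_vector_le:
  assumes c: "c > 0" and m: "m > 0" and \<sigma>: "\<sigma> > 0"
    and inj: "\<And>\<omega> v. m * norm v \<le> norm (v - Complex c \<omega> powr (- of_real \<alpha>) *s (map_matrix of_real A *v v))"
  shows "(\<Sum>i\<in>UNIV. gauss_energy \<sigma> (fourier (damped c (\<lambda>t. x t $ i)))) \<le>
     2 * pi * (2 / m\<^sup>2 * ((norm x0)\<^sup>2 / (2 * c) + (c powr (- \<alpha>) * \<eta>)\<^sup>2 * energy c x))"
proof -
  define W where "W w = exp (- (\<sigma> * w)\<^sup>2 / 2)" for w
  let ?X = "\<lambda>i. fourier (damped c (\<lambda>t. x t $ i))" and ?G = "\<lambda>i. fourier (damped c (\<lambda>t. g t $ i))"
    and ?One = "fourier (damped c (\<lambda>_. 1))"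
  have dx: "integrable lborel (damped c (\<lambda>t. x t $ i))" for i
    by (rule integrable_damped[OF cont_components(1) bound_components(1) c])
  have dg: "integrable lborel (damped c (\<lambda>t. g t $ i))" for i
    by (rule integrable_damped[OF cont_components(2) bound_components(2) c])
  have d1: "integrable lborel (damped c (\<lambda>_. 1))" "integrable lborel (\<lambda>t. (damped c (\<lambda>_. 1) t)\<^sup>2)"
    using integrable_damped[of "\<lambda>_. 1" 1 c] integrable_damped_square[of "\<lambda>_. 1" 1 c] c by auto
  have one: "?One w = 1 / Complex c w" for w
    using has_bochner_integral_exp_complex[of "Complex c w"] c
    by (simp add: laplace_eq_fourier[symmetric] laplace_def has_bochner_integral_iff)
  have square_sum_le: "(p + q)\<^sup>2 \<le> 2 * (p\<^sup>2 + q\<^sup>2)" for p q :: real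
    using sum_squares_bound[of p q] by (simp add: power2_sum)
  have ptw: "(\<Sum>i\<in>UNIV. (cmod (?X i w))\<^sup>2) \<le>
      2 / m\<^sup>2 * ((norm x0)\<^sup>2 * (cmod (?One w))\<^sup>2 + (c powr (- \<alpha>))\<^sup>2 * (\<Sum>i\<in>UNIV. (cmod (?G i w))\<^sup>2))" for w
  proof -
    define s where "s = Complex c w"
    have s: "Re s > 0" using c by (simp add: s_def)
    have cs: "c \<le> cmod s" using complex_Re_le_cmod[of s] by (simp add: s_def)
    define k where "k = s powr (- of_real \<alpha>)"
    have nk: "cmod k \<le> c powr (- \<alpha>)"
      using powr_mono2'[of "- \<alpha>" c "cmod s"] cs c \<alpha> by (simp add: k_def norm_powr_real_powr')
    let ?V = "vlaplace x s" and ?U = "vlaplace g s"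
    have "?V - k *s (map_matrix of_real A *v ?V) = (1 / s) *s complexify x0 + k *s ?U"
      using laplace_equation[OF s] by (simp add: k_def vec_eq_iff algebra_simps)
    then have "m * norm ?V \<le> norm ((1 / s) *s complexify x0 + k *s ?U)"
      using inj[of ?V w] by (simp add: k_def s_def)
    also have "\<dots> \<le> norm x0 * cmod (1 / s) + c powr (- \<alpha>) * norm ?U"
      by (rule order_trans[OF norm_triangle_ineq])
         (simp add: norm_vector_smult mult_right_mono nk mult.commute[of "norm x0"])
    finally have "(m * norm ?V)\<^sup>2 \<le> (norm x0 * cmod (1 / s) + c powr (- \<alpha>) * norm ?U)\<^sup>2"
      using m by (intro power_mono) auto
    also have "\<dots> \<le> 2 * ((norm x0 * cmod (1 / s))\<^sup>2 + (c powr (- \<alpha>) * norm ?U)\<^sup>2)"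
      by (rule square_sum_le)
    finally have "(norm ?V)\<^sup>2 \<le> 2 / m\<^sup>2 * ((norm x0)\<^sup>2 * (cmod (1 / s))\<^sup>2 + (c powr (- \<alpha>))\<^sup>2 * (norm ?U)\<^sup>2)"
      using m by (simp add: power_mult_distrib field_simps)
    then show ?thesis
      by (simp add: norm_sq_vec vlaplace_def s_def laplace_eq_fourier one)
  qed
  have iX: "integrable lborel (\<lambda>w. W w * (cmod (?X i w))\<^sup>2)"
    and iG: "integrable lborel (\<lambda>w. W w * (cmod (?G i w))\<^sup>2)"
    and i1: "integrable lborel (\<lambda>w. W w * (cmod (?One w))\<^sup>2)" for i
    using integrable_gauss_energy[OF \<sigma>] dx dg d1(1) by (auto simp: W_def)
  have "(\<Sum>i\<in>UNIV. gauss_energy \<sigma> (?X i)) = (LINT w|lborel. (\<Sum>i\<in>UNIV. W w * (cmod (?X i w))\<^sup>2))"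
    using iX by (simp add: gauss_energy_def W_def Bochner_Integration.integral_sum)
  also have "\<dots> \<le> (LINT w|lborel. 2 / m\<^sup>2 * ((norm x0)\<^sup>2 * (W w * (cmod (?One w))\<^sup>2) +
      (c powr (- \<alpha>))\<^sup>2 * (\<Sum>i\<in>UNIV. W w * (cmod (?G i w))\<^sup>2)))"
  proof (rule integral_mono)
    fix w
    have "W w * (\<Sum>i\<in>UNIV. (cmod (?X i w))\<^sup>2) \<le> W w * (2 / m\<^sup>2 * ((norm x0)\<^sup>2 * (cmod (?One w))\<^sup>2 + (c powr (- \<alpha>))\<^sup>2 * (\<Sum>i\<in>UNIV. (cmod (?G i w))\<^sup>2)))"
      by (rule mult_left_mono[OF ptw]) (simp add: W_def)
    also have "\<dots> = 2 / m\<^sup>2 * ((norm x0)\<^sup>2 * (W w * (cmod (?One w))\<^sup>2) + (c powr (- \<alpha>))\<^sup>2 * (W w * (\<Sum>i\<in>UNIV. (cmod (?G i w))\<^sup>2)))"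
      by (simp only: distrib_left mult_ac)
    finally show "(\<Sum>i\<in>UNIV. W w * (cmod (?X i w))\<^sup>2) \<le> 2 / m\<^sup>2 * ((norm x0)\<^sup>2 * (W w * (cmod (?One w))\<^sup>2) +
      (c powr (- \<alpha>))\<^sup>2 * (\<Sum>i\<in>UNIV. W w * (cmod (?G i w))\<^sup>2))"
      by (simp only: sum_distrib_left)
  qed (intro integrable_mult_right Bochner_Integration.integrable_add Bochner_Integration.integrable_sum iX iG i1)+
  also have "\<dots> = 2 / m\<^sup>2 * ((norm x0)\<^sup>2 * gauss_energy \<sigma> ?One + (c powr (- \<alpha>))\<^sup>2 * (\<Sum>i\<in>UNIV. gauss_energy \<sigma> (?G i)))"
    unfolding gauss_energy_def W_def[symmetric]
    using i1 iG by (simp only: integral_mult_right_zero Bochner_Integration.integral_add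
        Bochner_Integration.integral_sum Bochner_Integration.integrable_sum integrable_mult_right)
  also have "\<dots> \<le> 2 / m\<^sup>2 * ((norm x0)\<^sup>2 * (2 * pi * (1 / (2 * c))) + (c powr (- \<alpha>))\<^sup>2 * (2 * pi * (\<eta>\<^sup>2 * energy c x)))"
  proof (intro mult_left_mono add_mono)
    have "(LINT t|lborel. (damped c (\<lambda>_. 1) t)\<^sup>2) = 1 / (2 * c)"
      unfolding damped_square using integrable_exp_halfline(2)[of "2 * c"] c by (simp add: damped_def)
    then show "gauss_energy \<sigma> ?One \<le> 2 * pi * (1 / (2 * c))"
      using gauss_energy_le[OF \<sigma> d1] by simp
    have "(\<Sum>i\<in>UNIV. gauss_energy \<sigma> (?G i)) \<le> (\<Sum>i\<in>UNIV. 2 * pi * (LINT t|lborel. (damped c (\<lambda>t. g t $ i) t)\<^sup>2))"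
      by (intro sum_mono gauss_energy_le \<sigma> dg damped_square_integrable c)
    also have "\<dots> = 2 * pi * energy c g" by (simp add: energy_def sum_distrib_left)
    also have "\<dots> \<le> 2 * pi * (\<eta>\<^sup>2 * energy c x)" using energy_perturbation_le[OF c] by simp
    finally show "(\<Sum>i\<in>UNIV. gauss_energy \<sigma> (?G i)) \<le> 2 * pi * (\<eta>\<^sup>2 * energy c x)" .
  qed auto
  also have "\<dots> = 2 * pi * (2 / m\<^sup>2 * ((norm x0)\<^sup>2 / (2 * c) + (c powr (- \<alpha>) * \<eta>)\<^sup>2 * energy c x))"
    by (simp add: power_mult_distrib algebra_simps)
  finally show ?thesis .
qed

text \<open>For small \<open>\<eta>\<close> the energy of \<open>g\<close> is absorbed into that of \<open>x\<close>.  The point of the result is that the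
a priori bound \<open>B\<close> on the solution has disappeared: the weighted norm of the whole solution is
controlled by the initial value alone.\<close>

lemma energy_le:
  assumes c: "c > 0" and m: "m > 0"
    and inj: "\<And>\<omega> v. m * norm v \<le> norm (v - Complex c \<omega> powr (- of_real \<alpha>) *s (map_matrix of_real A *v v))"
    and \<eta>_le: "c powr (- \<alpha>) * \<eta> \<le> m / 2"
  shows "energy c x \<le> 2 * (norm x0)\<^sup>2 / (m\<^sup>2 * c)"
proof -
  let ?R = "2 / m\<^sup>2 * ((norm x0)\<^sup>2 / (2 * c) + (c powr (- \<alpha>) * \<eta>)\<^sup>2 * energy c x)"
  have "(\<lambda>k. \<Sum>i\<in>UNIV. gauss_energy (1 / real (Suc k)) (fourier (damped c (\<lambda>t. x t $ i)))) \<longlonglongrightarrow>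
     (\<Sum>i\<in>UNIV. 2 * pi * (LINT t|lborel. (damped c (\<lambda>t. x t $ i) t)\<^sup>2))"
  proof (intro tendsto_sum gauss_energy_tendsto)
    fix i t
    have "B \<ge> 0" using bound[of 0] norm_ge_zero[of "x 0"] by linarith
    show "\<bar>damped c (\<lambda>t. x t $ i) t\<bar> \<le> B"
    proof (rule order_trans[OF abs_damped_le[OF bound_components(1)]])
      show "B * (indicator {0..} t * exp (- (c * t))) \<le> B"
        using \<open>B \<ge> 0\<close> c by (auto simp: indicator_def intro!: mult_left_le)
    qed
  qed (auto intro: integrable_damped[OF cont_components(1) bound_components(1) c] AE_isCont_damped[OF cont_components(1)])
  then have "(\<Sum>i\<in>UNIV. 2 * pi * (LINT t|lborel. (damped c (\<lambda>t. x t $ i) t)\<^sup>2)) \<le> 2 * pi * ?R"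
    by (rule LIMSEQ_le_const2) (intro exI allI impI gauss_energy_vector_le[OF c m _ inj], simp)
  then have "2 * pi * energy c x \<le> 2 * pi * ?R" by (simp add: energy_def sum_distrib_left)
  then have E: "energy c x \<le> ?R" by (simp only: mult_le_cancel_left_pos pi_gt_zero zero_less_mult_iff zero_less_numeral simp_thms)
  have "(c powr (- \<alpha>) * \<eta>)\<^sup>2 \<le> (m / 2)\<^sup>2" using \<eta>_le \<eta> by (intro power_mono) auto
  from mult_right_mono[OF this energy_nonneg[of c]]
  have "2 / m\<^sup>2 * ((c powr (- \<alpha>) * \<eta>)\<^sup>2 * energy c x) \<le> 2 / m\<^sup>2 * ((m / 2)\<^sup>2 * energy c x)"
    by (rule mult_left_mono) simp
  also have "\<dots> = energy c x / 2" using m by (simp add: power_divide)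
  finally have "energy c x / 2 \<le> 2 / m\<^sup>2 * ((norm x0)\<^sup>2 / (2 * c))"
    using E by (simp only: distrib_left)
  then show ?thesis using m c by (simp add: field_simps)
qed

text \<open>Strictly to the right of the line \<open>Re s = c\<close>, the transform of \<open>g\<close> is a pairing of the weighted
solution with a decaying exponential.  The inequality of the means, scaled by \<open>norm x0\<close>, makes both
terms linear in \<open>norm x0\<close> once the energy is of order \<open>(norm x0)\<^sup>2\<close>.\<close>

lemma laplace_perturbation_le:
  assumes c: "c > 0" and s: "Re s > c" and x0: "x0 \<noteq> 0"
  shows "cmod (laplace (\<lambda>t. g t $ i) s) \<le> \<eta> / 2 * (norm x0 / (2 * (Re s - c)) + energy c x / norm x0)"
proof -
  define d where "d = Re s - c"
  have d: "d > 0" using s by (simp add: d_def)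
  have n0: "norm x0 > 0" using x0 by simp
  let ?S = "\<lambda>t. \<Sum>j\<in>UNIV. (damped c (\<lambda>t. x t $ j) t)\<^sup>2"
  let ?b = "\<lambda>t. \<eta> / 2 * (norm x0 * (indicator {0..} t * exp (- ((2 * d) * t))) + ?S t / norm x0)"
  have ptw: "\<bar>damped (Re s) (\<lambda>t. g t $ i) t\<bar> \<le> ?b t" for t
  proof (cases "t \<ge> 0")
    case True
    define a where "a = exp (- (d * t))"
    define b where "b = exp (- (c * t)) * norm (x t)"
    have S: "?S t = b\<^sup>2" using True by (simp add: damped_def b_def norm_sq_vec power_mult_distrib sum_distrib_left)
    have "\<bar>g t $ i\<bar> \<le> \<eta> * norm (x t)" using component_le_norm_cart[of "g t" i] small[OF True] by linarith
    then have "\<bar>damped (Re s) (\<lambda>t. g t $ i) t\<bar> \<le> exp (- (Re s * t)) * (\<eta> * norm (x t))"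
      using True by (simp add: damped_def abs_mult)
    also have "exp (- (Re s * t)) = a * exp (- (c * t))"
      by (simp add: a_def d_def exp_add[symmetric] algebra_simps)
    also have "a * exp (- (c * t)) * (\<eta> * norm (x t)) = \<eta> * (a * b)" by (simp add: b_def)
    also have "a * b \<le> (norm x0 * a\<^sup>2 + b\<^sup>2 / norm x0) / 2"
    proof -
      have "0 \<le> (norm x0 * a - b)\<^sup>2 / norm x0" using n0 by simp
      also have "\<dots> = norm x0 * a\<^sup>2 + b\<^sup>2 / norm x0 - 2 * (a * b)"
        using n0 by (simp add: power2_eq_square field_simps)
      finally show ?thesis by simp
    qed
    also have "a\<^sup>2 = exp (- ((2 * d) * t))" by (simp add: a_def power2_eq_square exp_add[symmetric])
    finally show ?thesis using True \<eta> by (simp add: S mult_left_mono)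
  next
    case False
    then show ?thesis using \<eta> by (simp add: damped_def)
  qed
  have iS: "integrable lborel ?S" by (intro Bochner_Integration.integrable_sum damped_square_integrable c)
  have ie: "integrable lborel (\<lambda>t. indicator {0..} t * exp (- ((2 * d) * t)))"
    "(LINT t|lborel. indicator {0..} t * exp (- ((2 * d) * t))) = 1 / (2 * d)"
    using integrable_exp_halfline[of "2 * d"] d by auto
  have S: "(LINT t|lborel. ?S t) = energy c x"
    unfolding energy_def by (rule Bochner_Integration.integral_sum) (rule damped_square_integrable[OF c])
  have ib: "integrable lborel ?b"
    by (intro integrable_mult_right Bochner_Integration.integrable_add integrable_divide ie(1) iS)
  have "cmod (laplace (\<lambda>t. g t $ i) s) \<le> (LINT t|lborel. \<bar>damped (Re s) (\<lambda>t. g t $ i) t\<bar>)"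
    by (rule norm_laplace_le)
  also have "\<dots> \<le> (LINT t|lborel. ?b t)"
    using integrable_damped[OF cont_components(2) bound_components(2), of "Re s" i] s c
    by (intro integral_mono ib ptw integrable_abs) auto
  also have "\<dots> = \<eta> / 2 * (norm x0 * (1 / (2 * d)) + energy c x / norm x0)"
    using ie iS by (simp only: integral_mult_right_zero Bochner_Integration.integral_add integrable_mult_right integrable_divide integral_divide_zero S)
  finally show ?thesis by (simp add: d_def)
qed

text \<open>Pairing the Laplace equation with a left eigenvector \<open>w\<close> at a point where \<open>s powr \<alpha>\<close> is the
eigenvalue makes the transform of the solution cancel.  What remains expresses the unstable
component of the initial value by the transform of \<open>g\<close>; it is the condition under which a
bounded solution can exist.\<close>

lemma unstable_component_constraint:
  assumes s: "Re s > 0" and \<mu>: "s powr (- of_real \<alpha>) * \<mu> = 1"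
    and w: "\<And>u. (\<Sum>i\<in>UNIV. w $ i * (map_matrix complex_of_real A *v u) $ i) = \<mu> * (\<Sum>i\<in>UNIV. w $ i * u $ i)"
  shows "cmod (\<Sum>i\<in>UNIV. w $ i * of_real (x0 $ i)) \<le>
     cmod s * cmod (s powr (- of_real \<alpha>)) * (\<Sum>i\<in>UNIV. cmod (w $ i) * cmod (laplace (\<lambda>t. g t $ i) s))"
proof -
  define k where "k = s powr (- of_real \<alpha>)"
  let ?P = "\<lambda>u. \<Sum>i\<in>UNIV. w $ i * u $ i"
  have s0: "s \<noteq> 0" using s by auto
  have "?P (vlaplace x s) = (1 / s) * ?P (complexify x0) + k * (?P (map_matrix of_real A *v vlaplace x s) + ?P (vlaplace g s))"
    by (subst laplace_equation[OF s]) (simp add: k_def sum.distrib sum_distrib_left algebra_simps)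
  also have "k * (?P (map_matrix of_real A *v vlaplace x s) + ?P (vlaplace g s)) = (k * \<mu>) * ?P (vlaplace x s) + k * ?P (vlaplace g s)"
    unfolding w by (simp add: algebra_simps)
  finally have "(1 / s) * ?P (complexify x0) = - (k * ?P (vlaplace g s))"
    using \<mu> unfolding k_def[symmetric] by (simp add: eq_neg_iff_add_eq_0)
  then have "?P (complexify x0) = - (s * k * ?P (vlaplace g s))"
    using s0 by (simp add: field_simps)
  then have "cmod (?P (complexify x0)) = cmod s * cmod k * cmod (?P (vlaplace g s))"
    by (simp add: norm_mult)
  also have "\<dots> \<le> cmod s * cmod k * (\<Sum>i\<in>UNIV. cmod (w $ i) * cmod (laplace (\<lambda>t. g t $ i) s))"
    by (intro mult_left_mono order_trans[OF norm_sum]) (auto simp: norm_mult vlaplace_def)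
  finally show ?thesis by (simp add: k_def complexify_def)
qed

end

section \<open>Norms and the modulus of the nonlinearity\<close>

text \<open>The upper estimate comes from expanding in the basis; it makes \<open>N\<close> continuous, so that \<open>N\<close> attains a
positive minimum on the unit sphere.\<close>

lemma norm_equivalence:
  fixes N :: "'a::euclidean_space \<Rightarrow> real"
  assumes N: "is_norm N"
  obtains a b where "a > 0" "b > 0" "\<And>x. N x \<le> b * norm x" "\<And>x. norm x \<le> a * N x"
proof -
  have pos: "N x \<ge> 0" and zero: "N x = 0 \<longleftrightarrow> x = 0"
    and scale: "N (c *\<^sub>R x) = \<bar>c\<bar> * N x" and tri: "N (x + y) \<le> N x + N y" for c x y
    using N by (auto simp: is_norm_def)
  define b where "b = (\<Sum>e\<in>Basis. N e) + 1"
  have b: "b > 0" unfolding b_def by (intro add_nonneg_pos sum_nonneg pos) simp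
  have sum_le: "N (sum h S) \<le> (\<Sum>e\<in>S. N (h e))" if "finite S" for h :: "'a \<Rightarrow> 'a" and S
    using that
  proof (induction S rule: finite_induct)
    case empty
    then show ?case using zero[of 0] by simp
  next
    case (insert e S)
    then show ?case using tri[of "h e" "sum h S"] by simp
  qed
  have upper: "N x \<le> b * norm x" for x
  proof -
    have "N x = N (\<Sum>e\<in>Basis. (x \<bullet> e) *\<^sub>R e)" by (simp add: euclidean_representation)
    also have "\<dots> \<le> (\<Sum>e\<in>Basis. \<bar>x \<bullet> e\<bar> * N e)"
      using sum_le[of Basis "\<lambda>e. (x \<bullet> e) *\<^sub>R e"] by (simp add: scale)
    also have "\<dots> \<le> (\<Sum>e\<in>Basis. norm x * N e)"
      by (intro sum_mono mult_right_mono Basis_le_norm pos)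
    also have "\<dots> = norm x * (\<Sum>e\<in>Basis. N e)" by (rule sum_distrib_left[symmetric])
    also have "\<dots> \<le> b * norm x" by (simp add: b_def algebra_simps)
    finally show ?thesis .
  qed
  have diff: "\<bar>N x - N y\<bar> \<le> b * norm (x - y)" for x y
  proof -
    have "N x \<le> N (x - y) + N y" using tri[of "x - y" y] by simp
    moreover have "N y \<le> N (y - x) + N x" using tri[of "y - x" x] by simp
    ultimately show ?thesis
      using upper[of "x - y"] upper[of "y - x"] by (simp add: norm_minus_commute[of y x])
  qed
  have "b-lipschitz_on (sphere 0 1) N"
    by (rule lipschitz_onI) (use diff b in \<open>auto simp: dist_norm\<close>)
  then have cont: "continuous_on (sphere 0 1) N" by (rule lipschitz_on_continuous_on)
  have "sphere (0::'a) 1 \<noteq> {}" by (auto simp: vector_choose_size)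
  then obtain u where u: "norm u = 1" "\<And>v. norm v = 1 \<Longrightarrow> N u \<le> N v"
    using continuous_attains_inf[OF compact_sphere _ cont] by auto
  have Nu: "N u > 0" using u(1) pos[of u] zero[of u] by (cases "u = 0") auto
  have lower: "norm x \<le> 1 / N u * N x" for x
  proof (cases "x = 0")
    case False
    have "N u \<le> N (x /\<^sub>R norm x)" using False by (intro u(2)) simp
    also have "\<dots> = N x / norm x" unfolding scale using False by (simp add: field_simps)
    finally show ?thesis using False Nu by (simp add: field_simps)
  qed (use pos Nu in simp)
  from that[of "1 / N u" b] Nu b upper lower show ?thesis by simp
qed

lemma small_perturbation:
  assumes "(lip_modulus N f \<longlongrightarrow> 0) (at_right 0)" "f 0 = 0" "is_norm N" "\<eta> > 0"
  obtains r where "r > 0" "\<And>x. N x \<le> r \<Longrightarrow> N (f x) \<le> \<eta> * N x"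
proof -
  have "eventually (\<lambda>r. lip_modulus N f r < ereal \<eta>) (at_right 0)"
    using order_tendstoD(2)[OF assms(1), of "ereal \<eta>"] assms(4) by simp
  then have "eventually (\<lambda>r. lip_modulus N f r < ereal \<eta> \<and> r > 0) (at_right 0)"
    by (rule eventually_conj) (rule eventually_at_right_less)
  then obtain r where r: "lip_modulus N f r < ereal \<eta>" "r > 0"
    using eventually_happens trivial_limit_at_right_real by blast
  have N0: "N 0 = 0" and Npos: "x \<noteq> 0 \<Longrightarrow> N x > 0" for x
    using assms(3) unfolding is_norm_def by (auto simp: order_less_le)
  have "N (f x) \<le> \<eta> * N x" if x: "N x \<le> r" for x
  proof (cases "x = 0")
    case False
    have "ereal (N (f x - f 0) / N (x - 0)) \<le> lip_modulus N f r"
      unfolding lip_modulus_def using x r(2) False N0 by (intro SUP_upper2[of "(x, 0)"]) auto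
    also note r(1)
    finally have "N (f x) / N x < \<eta>" using assms(2) by simp
    then show ?thesis using Npos[OF False] by (simp add: field_simps)
  qed (simp add: assms(2) N0)
  with r(2) show ?thesis using that by blast
qed

section \<open>Fractional powers and the choice of a vertical line\<close>

text \<open>The function \<open>s powr \<alpha>\<close> maps the right half plane onto the sector of half opening
\<open>\<alpha> * pi / 2\<close>.  Hence an eigenvalue in that sector corresponds to a point \<open>s\<close> at which Laplace
transforms of bounded functions are defined.\<close>

lemma powr_inverse_exponent:
  assumes \<alpha>: "0 < \<alpha>" "\<alpha> < 1" and \<mu>: "\<mu> \<noteq> 0" "\<bar>Arg \<mu>\<bar> < \<alpha> * pi / 2"
  defines "s \<equiv> \<mu> powr (1 / of_real \<alpha>)"
  shows "Re s > 0" and "s powr (- of_real \<alpha>) * \<mu> = 1"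
proof -
  define z where "z = Ln \<mu> / of_real \<alpha>"
  have s: "s = exp z" using \<mu> by (simp add: s_def z_def powr_def)
  have "\<bar>Arg \<mu> / \<alpha>\<bar> < pi / 2" using \<mu>(2) \<alpha> by (simp add: field_simps)
  then have Im_z: "\<bar>Im z\<bar> < pi / 2" using \<mu>(1) by (simp add: z_def Arg_eq_Im_Ln)
  then have "cos (Im z) > 0" by (intro cos_gt_zero_pi) auto
  then show "Re s > 0" by (simp add: s Re_exp)
  have "Ln s = z" unfolding s using Im_z pi_gt_zero by (intro Ln_exp) (simp_all add: abs_less_iff)
  then have "s powr (- of_real \<alpha>) = exp (- Ln \<mu>)" using \<alpha> by (simp add: powr_def s z_def)
  then show "s powr (- of_real \<alpha>) * \<mu> = 1" using \<mu>(1) by (simp add: exp_minus)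
qed

lemma powr_powr_inverse:
  assumes \<alpha>: "0 < \<alpha>" "\<alpha> < 1" and s: "Re s > 0"
  shows "(s powr of_real \<alpha>) powr (1 / of_real \<alpha>) = s"
proof -
  have s0: "s \<noteq> 0" using s by auto
  have Im: "\<bar>Im (Ln s)\<bar> < pi / 2" using s s0 Re_Ln_pos_lt by blast
  have "\<bar>\<alpha> * Im (Ln s)\<bar> \<le> \<bar>Im (Ln s)\<bar>" using \<alpha> by (simp add: abs_mult mult_left_le_one_le)
  then have "Ln (exp (of_real \<alpha> * Ln s)) = of_real \<alpha> * Ln s"
    using Im pi_gt_zero by (intro Ln_exp) (simp_all add: abs_less_iff abs_le_iff)
  then show ?thesis using s0 \<alpha> by (simp add: powr_def)
qed

text \<open>Only finitely many vertical lines contain a point \<open>s\<close> for which \<open>s powr \<alpha>\<close> is an eigenvalue, so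
there is a line free of such points to the left of any prescribed one.\<close>

lemma line_avoiding_spectrum:
  fixes B :: "complex ^ 'n ^ 'n"
  assumes \<alpha>: "0 < \<alpha>" "\<alpha> < 1" and \<rho>: "\<rho> > 0"
  obtains c m where "0 < c" "c < \<rho>" "m > 0"
    "\<And>\<omega> v. m * norm v \<le> norm (v - Complex c \<omega> powr (- of_real \<alpha>) *s (B *v v))"
proof -
  define bad where "bad = (\<lambda>\<mu>. Re (\<mu> powr (1 / of_real \<alpha>))) ` {\<mu>. \<exists>v. v \<noteq> 0 \<and> B *v v = \<mu> *s v}"
  have "finite bad" unfolding bad_def by (intro finite_imageI finite_eigenvalues)
  moreover have "infinite {0<..<\<rho>}" using \<rho> by simp
  ultimately obtain c where c: "0 < c" "c < \<rho>" "c \<notin> bad"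
    by (metis finite_subset greaterThanLessThan_iff subsetI)
  define \<kappa> where "\<kappa> \<omega> = Complex c \<omega> powr (- of_real \<alpha>)" for \<omega>
  have "continuous_on UNIV (\<lambda>\<omega>. (of_real c + \<i> * of_real \<omega>) powr (- of_real \<alpha>))"
    using c(1) by (intro continuous_intros) (auto simp: complex_eq_iff)
  then have cont: "continuous_on UNIV \<kappa>" by (simp add: \<kappa>_def[abs_def] Complex_eq)
  have "filterlim (\<lambda>\<omega>. cmod (Complex c \<omega>)) at_top at_infinity"
    by (rule filterlim_at_top_mono[OF filterlim_norm_at_top])
       (auto intro!: always_eventually simp: order_trans[OF _ abs_Im_le_cmod])
  then have "((\<lambda>\<omega>. cmod (Complex c \<omega>) powr (- \<alpha>)) \<longlongrightarrow> 0) at_infinity"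
    by (rule tendsto_neg_powr[rotated]) (use \<alpha> in simp)
  then have "((\<lambda>\<omega>. cmod (\<kappa> \<omega>)) \<longlongrightarrow> 0) at_infinity"
    by (simp add: \<kappa>_def norm_powr_real_powr')
  then have lim: "(\<kappa> \<longlongrightarrow> 0) at_infinity"
    by (rule tendsto_norm_zero_cancel)
  have inj: "v = 0" if v: "v = \<kappa> \<omega> *s (B *v v)" for \<omega> v
  proof (rule ccontr)
    assume "v \<noteq> 0"
    define s where "s = Complex c \<omega>"
    have s: "Re s > 0" using c(1) by (simp add: s_def)
    have inv: "s powr of_real \<alpha> * \<kappa> \<omega> = 1"
    proof -
      have "s powr of_real \<alpha> \<noteq> 0" using s by (auto simp: powr_eq_0_iff)
      then show ?thesis by (simp add: \<kappa>_def s_def[symmetric] powr_minus)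
    qed
    have "s powr of_real \<alpha> *s (\<kappa> \<omega> *s (B *v v)) = (s powr of_real \<alpha> * \<kappa> \<omega>) *s (B *v v)"
      by simp
    then have "s powr of_real \<alpha> *s v = (s powr of_real \<alpha> * \<kappa> \<omega>) *s (B *v v)"
      unfolding v[symmetric] .
    then have "B *v v = s powr of_real \<alpha> *s v" using inv by simp
    with \<open>v \<noteq> 0\<close> have "Re ((s powr of_real \<alpha>) powr (1 / of_real \<alpha>)) \<in> bad" unfolding bad_def by blast
    then show False using c(3) powr_powr_inverse[OF \<alpha> s] by (simp add: s_def)
  qed
  obtain m where "m > 0" "\<And>\<omega> v. m * norm v \<le> norm (v - \<kappa> \<omega> *s (B *v v))"
    using uniform_injectivity[OF cont lim, of B] inj by metis
  then show ?thesis using that[OF c(1,2)] by (simp add: \<kappa>_def)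
qed

section \<open>Instability\<close>

theorem theorem5:
  fixes N :: "real ^ 'n \<Rightarrow> real" and \<alpha> :: real
    and A :: "real ^ 'n ^ 'n" and f :: "real ^ 'n \<Rightarrow> real ^ 'n"
  assumes "is_norm N"
    and "0 < \<alpha>" and "\<alpha> < 1"
    and "continuous_on UNIV f"
    and "\<exists>U L. open U \<and> 0 \<in> U \<and> L-lipschitz_on U f"
    and "spectrum A \<inter> {z. z \<noteq> 0 \<and> \<bar>Arg z\<bar> < \<alpha> * pi / 2} \<noteq> {}"
    and "f 0 = 0"
    and "(lip_modulus N f \<longlongrightarrow> 0) (at_right 0)"
  shows "trivial_solution_unstable N \<alpha> (\<lambda>x. A *v x + f x)"
  unfolding trivial_solution_unstable_def
proof
  assume stable: "trivial_solution_stable N \<alpha> (\<lambda>x. A *v x + f x)"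
  obtain \<mu> v where \<mu>: "\<mu> \<noteq> 0" "\<bar>Arg \<mu>\<bar> < \<alpha> * pi / 2"
    and v: "v \<noteq> 0" "map_matrix complex_of_real A *v v = \<mu> *s v"
    using assms(6) by (auto simp: spectrum_def)
  obtain w where w: "w \<noteq> 0" "\<And>u. (\<Sum>i\<in>UNIV. w $ i * (map_matrix complex_of_real A *v u) $ i) = \<mu> * (\<Sum>i\<in>UNIV. w $ i * u $ i)"
    using left_eigenvector[OF v] by blast
  obtain k where k: "w $ k \<noteq> 0" using w(1) by (auto simp: vec_eq_iff)
  define s where "s = \<mu> powr (1 / of_real \<alpha>)"
  have s: "Re s > 0" "s powr (- of_real \<alpha>) * \<mu> = 1"
    using powr_inverse_exponent[OF assms(2,3) \<mu>] by (simp_all add: s_def)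
  obtain c m where c: "0 < c" "c < Re s" and m: "m > 0"
    and inj: "\<And>\<omega> v. m * norm v \<le> norm (v - Complex c \<omega> powr (- of_real \<alpha>) *s (map_matrix of_real A *v v))"
    using line_avoiding_spectrum[OF assms(2,3) s(1), where B="map_matrix complex_of_real A"] by metis
  \<comment> \<open>With \<open>D\<close> from the energy estimate, \<open>\<eta> * C\<close> bounds the unstable component relative to \<open>norm x0\<close>.\<close>
  define D where "D = 1 / (2 * (Re s - c)) + 2 / (m\<^sup>2 * c)"
  define C where "C = cmod s * cmod (s powr (- of_real \<alpha>)) * (\<Sum>i\<in>UNIV. cmod (w $ i)) * (D / 2)"
  have C: "C \<ge> 0" unfolding C_def D_def using c m by (intro mult_nonneg_nonneg sum_nonneg) auto
  define \<eta> where "\<eta> = min (m / 2 * c powr \<alpha>) (cmod (w $ k) / (C + 1) / 2)"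
  have \<eta>: "\<eta> > 0" using m c k C by (simp add: \<eta>_def)
  have \<eta>m: "c powr (- \<alpha>) * \<eta> \<le> m / 2"
  proof -
    have "c powr (- \<alpha>) * \<eta> \<le> c powr (- \<alpha>) * (m / 2 * c powr \<alpha>)"
      unfolding \<eta>_def by (intro mult_left_mono min.cobounded1) simp
    also have "\<dots> = m / 2" using c(1) by (simp add: powr_minus)
    finally show ?thesis .
  qed
  have \<eta>C: "\<eta> * C < cmod (w $ k)"
  proof -
    have "\<eta> * C \<le> cmod (w $ k) / (C + 1) / 2 * (C + 1)"
      unfolding \<eta>_def using C by (intro mult_mono min.cobounded2) auto
    also have "\<dots> = cmod (w $ k) / 2" using C by (simp add: field_simps)
    also have "\<dots> < cmod (w $ k)" using k by simp
    finally show ?thesis .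
  qed
  obtain a b where ab: "a > 0" "b > 0" "\<And>x. N x \<le> b * norm x" "\<And>x. norm x \<le> a * N x"
    using norm_equivalence[OF assms(1)] by metis
  obtain \<epsilon> where \<epsilon>: "\<epsilon> > 0" "\<And>x. N x \<le> \<epsilon> \<Longrightarrow> N (f x) \<le> \<eta> / (a * b) * N x"
    using small_perturbation[OF assms(8,7,1), of "\<eta> / (a * b)"] \<eta> ab by auto
  have f_small: "norm (f x) \<le> \<eta> * norm x" if "N x \<le> \<epsilon>" for x
  proof -
    have "norm (f x) \<le> a * (\<eta> / (a * b) * (b * norm x))"
      using ab \<eta> by (intro order_trans[OF ab(4)] mult_left_mono order_trans[OF \<epsilon>(2)[OF that]]) auto
    then show ?thesis using ab by simp
  qed
  obtain \<delta> where \<delta>: "\<delta> > 0" "\<And>x0. N x0 < \<delta> \<Longrightarrow> \<exists>tmax \<phi>. maximal_caputo_solution \<alpha> (\<lambda>x. A *v x + f x) x0 tmax \<phi> \<and>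
           tmax = \<infinity> \<and> (\<forall>t\<ge>0. N (\<phi> t) \<le> \<epsilon>)"
    using stable \<epsilon>(1) unfolding trivial_solution_stable_def by metis
  \<comment> \<open>The initial value is \<open>e\<close> times a unit vector whose unstable component \<open>w $ k\<close> is nonzero; \<open>e\<close> is so small that \<open>N x0 \<le> \<delta> / 2\<close>.\<close>
  define e where "e = \<delta> / (2 * b)"
  define x0 :: "real ^ 'n" where "x0 = e *\<^sub>R axis k 1"
  have e: "e > 0" using \<delta>(1) ab(2) by (simp add: e_def)
  have norm_x0: "norm x0 = e" using e by (simp add: x0_def norm_axis_1)
  have "N x0 < \<delta>" using ab(3)[of x0] \<delta>(1) ab(2) by (simp add: norm_x0 e_def)
  then obtain x where x: "caputo_solution \<alpha> (\<lambda>x. A *v x + f x) x0 \<infinity> x" "\<And>t. t \<ge> 0 \<Longrightarrow> N (x t) \<le> \<epsilon>"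
    using \<delta>(2) unfolding maximal_caputo_solution_def by blast
  have cont: "continuous_on {0..} x" using x(1) by (simp add: caputo_solution_def atLeast_def)
  interpret bounded_solution \<alpha> \<eta> "a * \<epsilon>" A x "\<lambda>t. f (x t)" x0
  proof
    show "continuous_on {0..} (\<lambda>t. f (x t))"
      using continuous_on_compose2[OF assms(4) cont] by simp
    show "norm (x t) \<le> a * \<epsilon>" if "t \<ge> 0" for t
      using ab(4)[of "x t"] mult_left_mono[OF x(2)[OF that], of a] ab(1) by linarith
    show "x t = x0 + RL_integral \<alpha> (\<lambda>\<tau>. A *v x \<tau> + f (x \<tau>)) t" if "t \<ge> 0" for t
      using x(1) that by (simp add: caputo_solution_def)
  qed (use assms(2) \<eta> cont f_small x(2) in auto)
  have x0: "x0 \<noteq> 0" using e norm_x0 by auto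
  have L: "cmod (laplace (\<lambda>t. f (x t) $ i) s) \<le> \<eta> / 2 * D * e" for i
  proof -
    have "cmod (laplace (\<lambda>t. f (x t) $ i) s) \<le> \<eta> / 2 * (e / (2 * (Re s - c)) + energy c x / e)"
      using laplace_perturbation_le[OF c x0] by (simp add: norm_x0)
    also have "\<dots> \<le> \<eta> / 2 * (e / (2 * (Re s - c)) + 2 * e\<^sup>2 / (m\<^sup>2 * c) / e)"
      using energy_le[OF c(1) m inj \<eta>m] \<eta> e
      by (intro mult_left_mono add_left_mono divide_right_mono) (auto simp: norm_x0)
    also have "\<dots> = \<eta> / 2 * D * e"
      using e by (simp add: D_def power2_eq_square distrib_left distrib_right)
    finally show ?thesis .
  qed
  have "cmod (w $ k) * e = cmod (\<Sum>i\<in>UNIV. w $ i * of_real (x0 $ i))"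
  proof -
    have "(\<Sum>i\<in>UNIV. w $ i * of_real (x0 $ i)) = (\<Sum>i\<in>UNIV. if i = k then w $ k * of_real e else 0)"
      by (rule sum.cong) (auto simp: x0_def axis_def)
    then show ?thesis using e by (simp add: norm_mult)
  qed
  also have "\<dots> \<le> cmod s * cmod (s powr (- of_real \<alpha>)) * (\<Sum>i\<in>UNIV. cmod (w $ i) * cmod (laplace (\<lambda>t. f (x t) $ i) s))"
    by (rule unstable_component_constraint[OF s w(2)])
  also have "\<dots> \<le> cmod s * cmod (s powr (- of_real \<alpha>)) * (\<Sum>i\<in>UNIV. cmod (w $ i) * (\<eta> / 2 * D * e))"
    by (intro mult_left_mono sum_mono L) auto
  also have "\<dots> = \<eta> * C * e"
    unfolding C_def sum_distrib_right[symmetric] by simp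
  finally show False using \<eta>C e by simp
qed

end
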